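(* Let $\boldsymbol{d}=(d_1,\dots,d_N)\in\mathbb{D}$ and $\boldsymbol{d}'=(d'_1,\dots,d'_N)\in\mathbb{D}$. There exist a solution (minimizer) $\boldsymbol{z}^*(\boldsymbol{d})=(z^*_1(\boldsymbol{d}),\dots,z^*_N(\boldsymbol{d}))$ of $P(\boldsymbol{d})$ and a solution $\boldsymbol{z}^*(\boldsymbol{d}')=(z^*_1(\boldsymbol{d}'),\dots,z^*_N(\boldsymbol{d}'))$ of $P(\boldsymbol{d}')$ such that for every $i\in\{1,\dots,N\}$ $$\|z^*_i(\boldsymbol{d})-z^*_i(\boldsymbol{d}')\|\le \sum_{j=1}^N \Gamma\,\rho^{(|i-j|-1)_+}\,\|d_j-d'_j\|,$$ where $$\Gamma:=\frac{\overline{\sigma}}{\underline{\sigma}^2},\qquad \rho:=\frac{\overline{\sigma}^2-\underline{\sigma}^2}{\overline{\sigma}^2+\underline{\sigma}^2},\qquad \underline{\sigma}:=\min_{B\in\mathbb{B}}\sigma_{\min}(\boldsymbol{G}[B,:]),\qquad \overline{\sigma}:=\max_{B\in\mathbb{B}}\sigma_{\max}(\boldsymbol{G}[B,:]).$$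
   Context: Problem. Fix a horizon $N\ge 1$, dimensions $n_x,n_u,n_w$, and real matrices $A_i\in\mathbb{R}^{n_x\times n_x}$, $B_i\in\mathbb{R}^{n_x\times n_u}$ ($1\le i\le N-1$), $E_i\in\mathbb{R}^{n_w\times n_x}$, $F_i\in\mathbb{R}^{n_w\times n_u}$ ($1\le i\le N$). Set $n:=n_x+n_u$ and $m:=4n_x+2n_u+2n_w$. For $1\le i\le N$ let $G_{i,i}\in\mathbb{R}^{m\times n}$ be the matrix whose block rows, in order, are $[I_{n_x}\;0]$, $[-I_{n_x}\;0]$, $[E_i\;F_i]$, $[-E_i\;-F_i]$, $[I_{n_x}\;0]$, $[-I_{n_x}\;0]$, $[0\;I_{n_u}]$, $[0\;-I_{n_u}]$. For $2\le i\le N$ let $G_{i,i-1}\in\mathbb{R}^{m\times n}$ be the matrix whose first two block rows (each of height $n_x$) are $[-A_{i-1}\;-B_{i-1}]$ and $[A_{i-1}\;B_{i-1}]$ and whose remaining rows are zero. Set $G_{i,j}:=0$ for all other $i,j$. Let $\boldsymbol{G}:=(G_{i,j})_{i,j=1}^N\in\mathbb{R}^{mN\times nN}$ be the resulting block matrix, and fix $\boldsymbol{p}\in\mathbb{R}^{nN}$. For $\boldsymbol{d}=(d_1,\dots,d_N)\in\mathbb{R}^{mN}$ with $d_i\in\mathbb{R}^m$, $P(\boldsymbol{d})=P(\boldsymbol{d};\boldsymbol{G},\boldsymbol{p})$ is the linear program $$\min_{\boldsymbol{z}\in\mathbb{R}^{nN}}\boldsymbol{p}^\top\boldsymbol{z}\quad\text{s.t.}\quad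 \boldsymbol{G}\boldsymbol{z}\ge\boldsymbol{d}$$ (componentwise inequality), with $\boldsymbol{z}=(z_1,\dots,z_N)$, $z_i\in\mathbb{R}^n$. (This is the linear MPC problem with linear dynamics, algebraic constraints and lower/upper bounds on $z_i=(x_i,u_i)$.) Definitions. $\mathbb{D}:=\{\boldsymbol{d}\in\mathbb{R}^{mN}: P(\boldsymbol{d})\text{ is feasible}\}$. For $B\subseteq\{1,\dots,mN\}$, $\boldsymbol{G}[B,:]$ is the submatrix of rows indexed by $B$ (in increasing order) and $\boldsymbol{d}[B]$ the corresponding subvector. $B$ is a basis if $\boldsymbol{G}[B,:]$ is (square and) nonsingular; the basic solution associated with $B$ is the vector $\boldsymbol{z}^B(\boldsymbol{d})$ with $\boldsymbol{G}[B,:]\boldsymbol{z}^B(\boldsymbol{d})=\boldsymbol{d}[B]$. A basis $B$ is optimal for $P(\boldsymbol{d})$ if $\boldsymbol{z}^B(\boldsymbol{d})$ is an optimal solution of $P(\boldsymbol{d})$. $\mathbb{B}$ is the (finite) set of all bases $B$ that are optimal for $P(\boldsymbol{d})$ for some $\boldsymbol{d}\in\mathbb{D}$. Notation. $\|\cdot\|$ is the Euclidean norm, $\sigma_{\min},\sigma_{\max}$ are the smallest and largest singular values, $(a)_+:=\max(0,a)$. *)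

theory Defs
  imports "Jordan_Normal_Form.DL_Submatrix" "Jordan_Normal_Form.Char_Poly"
begin

definition euclid_norm :: "real vec \<Rightarrow> real" where
  "euclid_norm v = sqrt (v \<bullet> v)"

(* For a square A these are exactly the singular values of A (for a wide A the extra
   value 0 would appear); below it is only applied to square matrices. *)
definition singular_values :: "real mat \<Rightarrow> real set" where
  "singular_values A = sqrt ` {k. eigenvalue (transpose_mat A * A) k}"

definition sigma_min :: "real mat \<Rightarrow> real" where
  "sigma_min A = Min (singular_values A)"

definition sigma_max :: "real mat \<Rightarrow> real" where
  "sigma_max A = Max (singular_values A)"


(* Linear programs  min p^T z  s.t.  G z >= d.
   The order on vectors is the componentwise one and includes equality of dimensions. *)

definition lp_feasible :: "real mat \<Rightarrow> real vec \<Rightarrow> real vec \<Rightarrow> bool" where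
  "lp_feasible G d z \<longleftrightarrow> z \<in> carrier_vec (dim_col G) \<and> d \<le> G *\<^sub>v z"

definition lp_solution :: "real mat \<Rightarrow> real vec \<Rightarrow> real vec \<Rightarrow> real vec \<Rightarrow> bool" where
  "lp_solution G p d z \<longleftrightarrow>
     lp_feasible G d z \<and> (\<forall>y. lp_feasible G d y \<longrightarrow> p \<bullet> z \<le> p \<bullet> y)"

definition lp_feasible_data :: "real mat \<Rightarrow> real vec set" where
  "lp_feasible_data G = {d \<in> carrier_vec (dim_row G). \<exists>z. lp_feasible G d z}"

(* Row indices are 0-based: a row set is a subset of {..<dim_row G}. Both functions list
   the selected rows in increasing order, since "pick B k" is the k-th smallest
   element of B. *)
definition row_submatrix :: "real mat \<Rightarrow> nat set \<Rightarrow> real mat" where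
  "row_submatrix G B = submatrix G B UNIV"

definition subvector :: "real vec \<Rightarrow> nat set \<Rightarrow> real vec" where
  "subvector d B = vec (card {i. i < dim_vec d \<and> i \<in> B}) (\<lambda>k. d $ pick B k)"

(* invertible_mat includes being square *)
definition lp_basis :: "real mat \<Rightarrow> nat set \<Rightarrow> bool" where
  "lp_basis G B \<longleftrightarrow> B \<subseteq> {..<dim_row G} \<and> invertible_mat (row_submatrix G B)"

definition basic_solution :: "real mat \<Rightarrow> nat set \<Rightarrow> real vec \<Rightarrow> real vec" where
  "basic_solution G B d =
     (THE z. z \<in> carrier_vec (dim_col G) \<and> row_submatrix G B *\<^sub>v z = subvector d B)"

definition optimal_bases :: "real mat \<Rightarrow> real vec \<Rightarrow> nat set set" where
  "optimal_bases G p =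
     {B. lp_basis G B \<and> (\<exists>d \<in> lp_feasible_data G. lp_solution G p d (basic_solution G B d))}"

definition sigma_lower :: "real mat \<Rightarrow> real vec \<Rightarrow> real" where
  "sigma_lower G p = Min ((\<lambda>B. sigma_min (row_submatrix G B)) ` optimal_bases G p)"

definition sigma_upper :: "real mat \<Rightarrow> real vec \<Rightarrow> real" where
  "sigma_upper G p = Max ((\<lambda>B. sigma_max (row_submatrix G B)) ` optimal_bases G p)"


(* The constraint matrix of the linear MPC problem; stages are numbered 1, ..., N. *)

definition append_cols :: "real mat \<Rightarrow> real mat \<Rightarrow> real mat" where
  "append_cols X Y = four_block_mat X Y (0\<^sub>m 0 (dim_col X)) (0\<^sub>m 0 (dim_col Y))"

definition mpc_diag_block ::
  "nat \<Rightarrow> nat \<Rightarrow> (nat \<Rightarrow> real mat) \<Rightarrow> (nat \<Rightarrow> real mat) \<Rightarrow> nat \<Rightarrow> real mat" where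
  "mpc_diag_block nx nu E F i =
     append_cols (1\<^sub>m nx) (0\<^sub>m nx nu) @\<^sub>r
     append_cols (- 1\<^sub>m nx) (0\<^sub>m nx nu) @\<^sub>r
     append_cols (E i) (F i) @\<^sub>r
     append_cols (- E i) (- F i) @\<^sub>r
     append_cols (1\<^sub>m nx) (0\<^sub>m nx nu) @\<^sub>r
     append_cols (- 1\<^sub>m nx) (0\<^sub>m nx nu) @\<^sub>r
     append_cols (0\<^sub>m nu nx) (1\<^sub>m nu) @\<^sub>r
     append_cols (0\<^sub>m nu nx) (- 1\<^sub>m nu)"

definition mpc_sub_block ::
  "nat \<Rightarrow> nat \<Rightarrow> nat \<Rightarrow> (nat \<Rightarrow> real mat) \<Rightarrow> (nat \<Rightarrow> real mat) \<Rightarrow> nat \<Rightarrow> real mat" where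
  "mpc_sub_block nx nu nw A B i =
     append_cols (- A (i - 1)) (- B (i - 1)) @\<^sub>r
     append_cols (A (i - 1)) (B (i - 1)) @\<^sub>r
     0\<^sub>m (2 * nx + 2 * nu + 2 * nw) (nx + nu)"

definition mpc_block ::
  "nat \<Rightarrow> nat \<Rightarrow> nat \<Rightarrow> (nat \<Rightarrow> real mat) \<Rightarrow> (nat \<Rightarrow> real mat) \<Rightarrow>
   (nat \<Rightarrow> real mat) \<Rightarrow> (nat \<Rightarrow> real mat) \<Rightarrow> nat \<Rightarrow> nat \<Rightarrow> real mat" where
  "mpc_block nx nu nw A B E F i j =
     (if i = j then mpc_diag_block nx nu E F i
      else if i = j + 1 then mpc_sub_block nx nu nw A B i
      else 0\<^sub>m (4 * nx + 2 * nu + 2 * nw) (nx + nu))"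

(* Entry (r, c) with 0-based r, c lies in the block (r div m + 1, c div n + 1). *)
definition mpc_matrix ::
  "nat \<Rightarrow> nat \<Rightarrow> nat \<Rightarrow> nat \<Rightarrow> (nat \<Rightarrow> real mat) \<Rightarrow> (nat \<Rightarrow> real mat) \<Rightarrow>
   (nat \<Rightarrow> real mat) \<Rightarrow> (nat \<Rightarrow> real mat) \<Rightarrow> real mat" where
  "mpc_matrix N nx nu nw A B E F =
     (let n = nx + nu; m = 4 * nx + 2 * nu + 2 * nw in
      mat (m * N) (n * N) (\<lambda>(r, c).
        mpc_block nx nu nw A B E F (r div m + 1) (c div n + 1) $$ (r mod m, c mod n)))"

(* v = (v_1, ..., v_N) with blocks of length k; block i is 1-based. *)
definition vec_block :: "nat \<Rightarrow> real vec \<Rightarrow> nat \<Rightarrow> real vec" where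
  "vec_block k v i = vec k (\<lambda>l. v $ ((i - 1) * k + l))"

end

theory Submission
  imports Defs "Jordan_Normal_Form.Spectral_Radius"
    "HOL-Analysis.L2_Norm" "HOL-Analysis.Function_Topology"
begin

text \<open>
Fix a basis \<open>B\<close> and let \<open>M\<close> be the square matrix of its rows. The basic solution depends linearly on
the data, so a change \<open>y\<close> of the data changes it by the solution \<open>x\<close> of \<open>M x = y\<close>. Split \<open>y\<close> into
its stages; for a single stage \<open>j\<close> the claim is that \<open>x\<close> decays away from \<open>j\<close>. The Richardson
map \<open>K = I - 2 / (\<sigma>\<^sub>m\<^sub>i\<^sub>n\<^sup>2 + \<sigma>\<^sub>m\<^sub>a\<^sub>x\<^sup>2) M\<^sup>T M\<close> contracts by the factor \<open>\<rho>\<close>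
(\<open>richardson_contraction\<close>). On the other hand \<open>M\<close> is block bidiagonal, so \<open>q\<close> applications of \<open>K\<close>
do not alter the blocks of \<open>x\<close> whose distance from the stages \<open>j - 1\<close> and \<open>j\<close> is at least \<open>q\<close>
(\<open>richardson_iterate_local\<close>). With \<open>q\<close> the positive part of \<open>|i - j| - 1\<close> the block \<open>x\<^sub>i\<close> is
therefore a block of \<open>K\<^sup>q x\<close>, of norm at most \<open>\<rho>\<^sup>q |x| \<le> \<rho>\<^sup>q |y| / \<sigma>\<^sub>m\<^sub>i\<^sub>n\<close> (\<open>block_decay\<close>).
The constant \<open>1 / \<sigma>\<^sub>m\<^sub>i\<^sub>n\<close> is at most \<open>\<Gamma>\<close>.

The data \<open>d\<close> and \<open>d'\<close> need not share an optimal basis, so solutions are followed along the segment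
between them. Each basis is optimal on a closed set of parameters, finitely many of these sets cover
the segment, and the estimate, being proportional to the length travelled, adds up
(\<open>lipschitz_along_closed_cover\<close>). This needs a choice of solutions that does not jump
where the basis changes. Such a choice comes from a small perturbation \<open>p'\<close> of the cost
after which no dual variable of any basis vanishes (\<open>generic_cost\<close>): then
the solution is unique for every feasible datum (\<open>vertex_unique_optimum\<close>), it is attained at a dual
feasible basis (\<open>dual_simplex\<close>), and that basis remains dual feasible, hence optimal, for
the original cost.

A dual feasible basis to start from consists of lower and upper bounds on the components of \<open>z\<close>, one
for each component, with the side given by the sign of the cost.

Vectors are functions on \<open>nat\<close> of which only the values below \<open>n\<close> matter, and a basis is used through
the inverse of its row matrix with columns labelled by the rows (\<open>dual_rows\<close>).
\<close>

section \<open>Inner products\<close>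

definition dot :: "nat \<Rightarrow> (nat \<Rightarrow> real) \<Rightarrow> (nat \<Rightarrow> real) \<Rightarrow> real" where
  "dot n u v = (\<Sum>c<n. u c * v c)"

lemma dot_commute: "dot n u v = dot n v u"
  by (simp add: dot_def mult.commute)

lemma dot_add_right: "dot n u (\<lambda>c. v c + w c) = dot n u v + dot n u w"
  by (simp add: dot_def distrib_left sum.distrib)

lemma dot_diff_right: "dot n u (\<lambda>c. v c - w c) = dot n u v - dot n u w"
  by (simp add: dot_def right_diff_distrib sum_subtractf)

lemma dot_scale_right: "dot n u (\<lambda>c. k * v c) = k * dot n u v"
  by (simp add: dot_def sum_distrib_left mult.left_commute)

lemma dot_sum_right: "dot n u (\<lambda>c. \<Sum>b\<in>B. k b * v b c) = (\<Sum>b\<in>B. k b * dot n u (v b))"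
  unfolding dot_def sum_distrib_left by (subst sum.swap) (simp add: mult_ac)

lemma sum_of_bool_eq:
  fixes f :: "'a \<Rightarrow> real"
  assumes "finite S" "a \<in> S"
  shows "(\<Sum>b\<in>S. f b * of_bool (a = b)) = f a" "(\<Sum>b\<in>S. f b * of_bool (b = a)) = f a"
  using assms by (simp_all add: of_bool_def if_distrib cong: if_cong)

lemma dot_cong: "(\<And>c. c < n \<Longrightarrow> u c = u' c) \<Longrightarrow> (\<And>c. c < n \<Longrightarrow> v c = v' c) \<Longrightarrow> dot n u v = dot n u' v'"
  by (simp add: dot_def)

lemma dot_self: "dot n x x = (L2_set x {..<n})\<^sup>2"
  by (simp add: dot_def L2_set_def sum_nonneg power2_eq_square)

lemma dot_self_pos: "c < n \<Longrightarrow> x c \<noteq> 0 \<Longrightarrow> dot n x x > 0"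
  unfolding dot_def by (rule sum_pos2[of _ c]) (auto simp: zero_less_mult_iff)

section \<open>Bases and basic solutions\<close>

text \<open>
The vectors \<open>W b\<close> are the columns of the inverse of the matrix whose rows are \<open>g b\<close> for
\<open>b \<in> B\<close>. The columns are labelled by the rows \<open>b\<close> themselves and not by their positions in
\<open>B\<close>, so that exchanging one row for another leaves all other labels in place. The
two-sided inverse forces \<open>card B = n\<close>, so the row matrix is square.
\<close>

definition dual_rows ::
  "nat \<Rightarrow> (nat \<Rightarrow> nat \<Rightarrow> real) \<Rightarrow> nat set \<Rightarrow> (nat \<Rightarrow> nat \<Rightarrow> real) \<Rightarrow> bool" where
  "dual_rows n g B W \<longleftrightarrow> finite B \<and>
     (\<forall>a\<in>B. \<forall>b\<in>B. dot n (g a) (W b) = of_bool (a = b)) \<and>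
     (\<forall>c<n. \<forall>c'<n. (\<Sum>b\<in>B. W b c * g b c') = of_bool (c = c'))"

lemma dual_rows_expand:
  assumes "dual_rows n g B W" "c < n"
  shows "x c = (\<Sum>b\<in>B. dot n (g b) x * W b c)"
proof -
  have "(\<Sum>b\<in>B. dot n (g b) x * W b c) = (\<Sum>c'<n. x c' * (\<Sum>b\<in>B. W b c * g b c'))"
    unfolding dot_def sum_distrib_left sum_distrib_right
    by (subst sum.swap) (simp add: mult_ac)
  also have "\<dots> = (\<Sum>c'<n. x c' * of_bool (c = c'))"
    using assms by (intro sum.cong) (auto simp: dual_rows_def)
  also have "\<dots> = x c" using assms(2) by (intro sum_of_bool_eq) auto
  finally show ?thesis by simp
qed

text \<open>
A cost vector \<open>p\<close> is the combination of the rows in \<open>B\<close> with coefficients \<open>dot n p (W b)\<close>.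
These coefficients are the dual variables of the linear program at the basis \<open>B\<close>: the
basis is dual feasible when none of them is negative.
\<close>

lemma dual_rows_expand_functional:
  assumes "dual_rows n g B W"
  shows "dot n p x = (\<Sum>b\<in>B. dot n p (W b) * dot n (g b) x)"
proof -
  have "dot n p x = dot n p (\<lambda>c. \<Sum>b\<in>B. dot n (g b) x * W b c)"
    using dual_rows_expand[OF assms] by (intro dot_cong) auto
  then show ?thesis unfolding dot_sum_right by (simp add: mult.commute)
qed

lemma dual_rows_unique:
  assumes "dual_rows n g B W" "dual_rows n g B W'" "b \<in> B" "c < n"
  shows "W' b c = W b c"
proof -
  have "W' b c = (\<Sum>a\<in>B. dot n (g a) (W' b) * W a c)"
    by (rule dual_rows_expand[OF assms(1,4)])
  also have "\<dots> = (\<Sum>a\<in>B. W a c * of_bool (a = b))"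
    using assms(2,3) by (intro sum.cong) (auto simp: dual_rows_def)
  also have "\<dots> = W b c"
    using assms(1,3) by (intro sum_of_bool_eq) (auto simp: dual_rows_def)
  finally show ?thesis .
qed

lemma dual_rows_nonzero:
  assumes "dual_rows n g B W" "b \<in> B"
  shows "\<exists>c<n. W b c \<noteq> 0"
proof (rule ccontr)
  assume "\<not> ?thesis"
  then have "dot n (g b) (W b) = 0" by (auto simp: dot_def intro!: sum.neutral)
  then show False using assms by (auto simp: dual_rows_def)
qed

definition vertex :: "nat set \<Rightarrow> (nat \<Rightarrow> nat \<Rightarrow> real) \<Rightarrow> (nat \<Rightarrow> real) \<Rightarrow> nat \<Rightarrow> real" where
  "vertex B W d c = (\<Sum>b\<in>B. d b * W b c)"

lemma dot_vertex: "dot n p (vertex B W d) = (\<Sum>b\<in>B. d b * dot n p (W b))"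
  unfolding vertex_def by (rule dot_sum_right)

lemma row_vertex:
  assumes "dual_rows n g B W" "a \<in> B"
  shows "dot n (g a) (vertex B W d) = d a"
proof -
  have "dot n (g a) (vertex B W d) = (\<Sum>b\<in>B. d b * of_bool (a = b))"
    unfolding dot_vertex using assms by (intro sum.cong) (auto simp: dual_rows_def)
  also have "\<dots> = d a" using assms by (intro sum_of_bool_eq) (auto simp: dual_rows_def)
  finally show ?thesis .
qed

definition feasible ::
  "nat \<Rightarrow> (nat \<Rightarrow> nat \<Rightarrow> real) \<Rightarrow> nat set \<Rightarrow> (nat \<Rightarrow> real) \<Rightarrow> (nat \<Rightarrow> real) \<Rightarrow> bool" where
  "feasible n g R d z \<longleftrightarrow> (\<forall>r\<in>R. d r \<le> dot n (g r) z)"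

text \<open>
Weak duality: along a dual feasible basis the cost of any point is a nonnegative
combination of its row values, and at the vertex each of these takes its least allowed value.
\<close>

lemma vertex_optimal:
  assumes "dual_rows n g B W" "B \<subseteq> R" "\<forall>b\<in>B. dot n p (W b) \<ge> 0" "feasible n g R d y"
  shows "dot n p (vertex B W d) \<le> dot n p y"
  unfolding dot_vertex dual_rows_expand_functional[OF assms(1), of p y]
proof (rule sum_mono)
  fix b assume "b \<in> B"
  then have "d b \<le> dot n (g b) y" "dot n p (W b) \<ge> 0" using assms by (auto simp: feasible_def)
  then show "d b * dot n p (W b) \<le> dot n p (W b) * dot n (g b) y"
    by (metis mult.commute mult_left_mono)
qed

text \<open>
If all dual variables are strictly positive, a point that is as cheap as the vertex cannot
exceed any of the lower bounds in \<open>B\<close>, so it satisfies the same square system as the vertex.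
\<close>

lemma vertex_unique_optimum:
  assumes W: "dual_rows n g B W" and "B \<subseteq> R" and pos: "\<forall>b\<in>B. dot n p (W b) > 0"
    and feas: "feasible n g R d y" and le: "dot n p y \<le> dot n p (vertex B W d)" and "c < n"
  shows "y c = vertex B W d c"
proof -
  have fin: "finite B" using W by (simp add: dual_rows_def)
  have nn: "0 \<le> dot n p (W b) * (dot n (g b) y - d b)" if "b \<in> B" for b
    using that pos feas \<open>B \<subseteq> R\<close> by (intro mult_nonneg_nonneg) (auto simp: feasible_def intro: less_imp_le)
  have "(\<Sum>b\<in>B. dot n p (W b) * (dot n (g b) y - d b)) = dot n p y - dot n p (vertex B W d)"
    unfolding dot_vertex dual_rows_expand_functional[OF W, of p y]
    by (simp add: right_diff_distrib sum_subtractf mult.commute)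
  then have "(\<Sum>b\<in>B. dot n p (W b) * (dot n (g b) y - d b)) = 0"
    using le sum_nonneg[of B "\<lambda>b. dot n p (W b) * (dot n (g b) y - d b)", OF nn] by linarith
  then have "\<forall>b\<in>B. dot n p (W b) * (dot n (g b) y - d b) = 0"
    using nn by (subst (asm) sum_nonneg_eq_0_iff[OF fin]) auto
  then have "\<forall>b\<in>B. dot n (g b) y = d b" using pos by force
  then show ?thesis
    using dual_rows_expand[OF W \<open>c < n\<close>, of y] by (simp add: vertex_def)
qed

section \<open>The dual simplex method\<close>

text \<open>
The inverse after row \<open>r\<close> has replaced row \<open>b0\<close> (one Gauss--Jordan step). It is the inverse of the
new row set as soon as the pivot element \<open>dot n (g r) (W b0)\<close> is nonzero.
\<close>

definition pivot ::
  "nat \<Rightarrow> (nat \<Rightarrow> nat \<Rightarrow> real) \<Rightarrow> (nat \<Rightarrow> nat \<Rightarrow> real) \<Rightarrow> nat \<Rightarrow> nat \<Rightarrow> nat \<Rightarrow> nat \<Rightarrow> real" where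
  "pivot n g W b0 r b c =
     (if b = r then W b0 c / dot n (g r) (W b0)
      else W b c - dot n (g r) (W b) / dot n (g r) (W b0) * W b0 c)"

lemma dot_pivot:
  "dot n u (pivot n g W b0 r b) =
     (if b = r then dot n u (W b0) / dot n (g r) (W b0)
      else dot n u (W b) - dot n (g r) (W b) / dot n (g r) (W b0) * dot n u (W b0))"
proof (cases "b = r")
  case True
  then have "pivot n g W b0 r b = (\<lambda>c. 1 / dot n (g r) (W b0) * W b0 c)"
    by (simp add: pivot_def fun_eq_iff)
  then show ?thesis using True by (simp only: dot_scale_right) simp
next
  case False
  then have "pivot n g W b0 r b
      = (\<lambda>c. W b c - dot n (g r) (W b) / dot n (g r) (W b0) * W b0 c)"
    by (simp add: pivot_def fun_eq_iff)
  then show ?thesis using False by (simp only: dot_scale_right dot_diff_right) simp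
qed

lemma dual_rows_exchange:
  assumes W: "dual_rows n g B W" and b0: "b0 \<in> B" and r: "r \<notin> B"
    and piv: "dot n (g r) (W b0) \<noteq> 0"
  shows "dual_rows n g (insert r (B - {b0})) (pivot n g W b0 r)"
proof -
  let ?W' = "pivot n g W b0 r"
  define \<mu> where "\<mu> = (\<lambda>b. dot n (g r) (W b))"
  have fin: "finite B" and gW: "\<And>a b. a \<in> B \<Longrightarrow> b \<in> B \<Longrightarrow> dot n (g a) (W b) = of_bool (a = b)"
    and Wg: "\<And>c c'. c < n \<Longrightarrow> c' < n \<Longrightarrow> (\<Sum>b\<in>B. W b c * g b c') = of_bool (c = c')"
    using W by (auto simp: dual_rows_def)
  have \<mu>0: "\<mu> b0 \<noteq> 0" using piv by (simp add: \<mu>_def)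
  have W'_def: "?W' b c = (if b = r then W b0 c / \<mu> b0 else W b c - \<mu> b / \<mu> b0 * W b0 c)" for b c
    by (simp add: pivot_def \<mu>_def)
  have 1: "dot n (g a) (?W' b) = of_bool (a = b)"
    if a: "a \<in> insert r (B - {b0})" and b: "b \<in> insert r (B - {b0})" for a b
  proof (cases "b = r")
    case True
    show ?thesis
    proof (cases "a = r")
      case True
      then show ?thesis using \<open>b = r\<close> piv by (simp add: dot_pivot \<mu>_def)
    next
      case False
      then show ?thesis using \<open>b = r\<close> a gW[OF _ b0, of a] by (auto simp: dot_pivot)
    qed
  next
    case b': False
    then have bB: "b \<in> B" using b by auto
    show ?thesis
    proof (cases "a = r")
      case True
      then show ?thesis using b' piv by (simp add: dot_pivot \<mu>_def)
    next
      case False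
      then show ?thesis using b' a gW[OF _ b0, of a] gW[OF _ bB, of a] by (auto simp: dot_pivot)
    qed
  qed
  have gr: "g r c' = (\<Sum>b\<in>B. \<mu> b * g b c')" if "c' < n" for c'
  proof -
    have "(\<Sum>b\<in>B. \<mu> b * g b c') = (\<Sum>c<n. g r c * (\<Sum>b\<in>B. W b c * g b c'))"
      unfolding \<mu>_def dot_def sum_distrib_left sum_distrib_right
      by (subst sum.swap) (simp add: mult_ac)
    also have "\<dots> = (\<Sum>c<n. g r c * of_bool (c = c'))" using Wg that by simp
    also have "\<dots> = g r c'" using that by (intro sum_of_bool_eq) auto
    finally show ?thesis by simp
  qed
  have 2: "(\<Sum>b\<in>insert r (B - {b0}). ?W' b c * g b c') = of_bool (c = c')" if c: "c < n" "c' < n" for c c'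
  proof -
    have "(\<Sum>b\<in>insert r (B - {b0}). ?W' b c * g b c')
        = W b0 c / \<mu> b0 * g r c' + (\<Sum>b\<in>B - {b0}. ?W' b c * g b c')"
      using fin r by (simp add: W'_def)
    also have "(\<Sum>b\<in>B - {b0}. ?W' b c * g b c')
        = (\<Sum>b\<in>B - {b0}. W b c * g b c' - W b0 c / \<mu> b0 * (\<mu> b * g b c'))"
      using r by (intro sum.cong) (auto simp: W'_def algebra_simps)
    also have "\<dots> = (\<Sum>b\<in>B. W b c * g b c' - W b0 c / \<mu> b0 * (\<mu> b * g b c'))"
      using sum.remove[OF fin b0, of "\<lambda>b. W b c * g b c' - W b0 c / \<mu> b0 * (\<mu> b * g b c')"] \<mu>0 by simp
    also have "\<dots> = of_bool (c = c') - W b0 c / \<mu> b0 * g r c'"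
      using Wg[OF c] gr[OF c(2)] by (simp only: sum_subtractf sum_distrib_left)
    finally show ?thesis by simp
  qed
  show ?thesis unfolding dual_rows_def using fin 1 2 by auto
qed

text \<open>
The pivot changes the value of the dual program by the ratio of the leaving dual variable to
the pivot element, times the amount by which the old vertex violates the entering row.
\<close>

lemma vertex_exchange_value:
  assumes W: "dual_rows n g B W" and b0: "b0 \<in> B" and r: "r \<notin> B"
    and piv: "dot n (g r) (W b0) \<noteq> 0"
  shows "dot n p (vertex (insert r (B - {b0})) (pivot n g W b0 r) d)
       = dot n p (vertex B W d) +
         dot n p (W b0) / dot n (g r) (W b0) * (d r - dot n (g r) (vertex B W d))"
proof -
  define \<mu> where "\<mu> = (\<lambda>b. dot n (g r) (W b))"
  have fin: "finite B" using W by (auto simp: dual_rows_def)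
  let ?\<theta> = "dot n p (W b0) / \<mu> b0"
  have "dot n p (vertex (insert r (B - {b0})) (pivot n g W b0 r) d)
      = d r * ?\<theta> + (\<Sum>b\<in>B - {b0}. d b * dot n p (pivot n g W b0 r b))"
    using fin r by (simp add: dot_vertex dot_pivot \<mu>_def)
  also have "(\<Sum>b\<in>B - {b0}. d b * dot n p (pivot n g W b0 r b))
      = (\<Sum>b\<in>B - {b0}. d b * (dot n p (W b) - \<mu> b / \<mu> b0 * dot n p (W b0)))"
    using r by (intro sum.cong) (auto simp: dot_pivot \<mu>_def)
  also have "\<dots> = (\<Sum>b\<in>B. d b * dot n p (W b) - ?\<theta> * (d b * \<mu> b))"
    using sum.remove[OF fin b0, of "\<lambda>b. d b * (dot n p (W b) - \<mu> b / \<mu> b0 * dot n p (W b0))"] piv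
    by (simp add: \<mu>_def algebra_simps)
  also have "\<dots> = dot n p (vertex B W d) - ?\<theta> * dot n (g r) (vertex B W d)"
    by (simp only: sum_subtractf dot_vertex \<mu>_def sum_distrib_left)
  finally show ?thesis
    by (simp add: right_diff_distrib diff_divide_distrib mult.commute \<mu>_def)
qed

text \<open>
Existence of a basis that is at once dual and primal feasible. Among the finitely many dual
feasible bases, one that maximises the cost of its vertex does the job: if its vertex violated
a row, either all entries of that row relative to the basis would be nonpositive, which
contradicts the existence of a feasible point, or a dual simplex pivot would lead to another dual
feasible basis. Since no dual variable vanishes, that pivot increases the maximised value
strictly.
\<close>

lemma dual_simplex:
  assumes fin: "finite R"
    and generic: "\<And>B W b. dual_rows n g B W \<Longrightarrow> B \<subseteq> R \<Longrightarrow> b \<in> B \<Longrightarrow> dot n p (W b) \<noteq> 0"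
    and start: "dual_rows n g B0 W0" "B0 \<subseteq> R" "\<forall>b\<in>B0. dot n p (W0 b) \<ge> 0"
    and y: "feasible n g R d y"
  obtains B W where "dual_rows n g B W" "B \<subseteq> R" "\<forall>b\<in>B. dot n p (W b) > 0"
    "feasible n g R d (vertex B W d)"
proof -
  define \<B> where "\<B> = {B. B \<subseteq> R \<and> (\<exists>W. dual_rows n g B W \<and> (\<forall>b\<in>B. dot n p (W b) > 0))}"
  have "\<exists>V. \<forall>B\<in>\<B>. dual_rows n g B (V B) \<and> (\<forall>b\<in>B. dot n p (V B b) > 0)"
    by (rule bchoice) (auto simp: \<B>_def)
  then obtain V where V: "\<And>B. B \<in> \<B> \<Longrightarrow> dual_rows n g B (V B)"
    and Vpos: "\<And>B b. B \<in> \<B> \<Longrightarrow> b \<in> B \<Longrightarrow> dot n p (V B b) > 0" by blast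
  have "finite \<B>" by (rule finite_subset[of _ "Pow R"]) (auto simp: \<B>_def fin)
  have "\<forall>b\<in>B0. dot n p (W0 b) > 0" using start generic[OF start(1,2)] by (metis less_le)
  then have "B0 \<in> \<B>" using start unfolding \<B>_def by blast
  define val where "val B = dot n p (vertex B (V B) d)" for B
  have "Max (val ` \<B>) \<in> val ` \<B>" using \<open>finite \<B>\<close> \<open>B0 \<in> \<B>\<close> by (intro Max_in) auto
  then obtain B where B: "B \<in> \<B>" and maxi: "\<And>B'. B' \<in> \<B> \<Longrightarrow> val B' \<le> val B"
    using \<open>finite \<B>\<close> by (metis (no_types, lifting) Max_ge finite_imageI image_eqI imageE)
  let ?W = "V B" and ?z = "vertex B (V B) d"
  note W = V[OF B]
  have BR: "B \<subseteq> R" and finB: "finite B" using B W by (auto simp: \<B>_def dual_rows_def)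
  have "feasible n g R d ?z"
  proof (rule ccontr)
    assume "\<not> feasible n g R d ?z"
    then obtain r where rR: "r \<in> R" and viol: "dot n (g r) ?z < d r"
      by (auto simp: feasible_def not_le)
    have rB: "r \<notin> B" using viol row_vertex[OF W, of r d] by auto
    define \<mu> where "\<mu> b = dot n (g r) (?W b)" for b
    \<comment> \<open>If no entry were positive, the rows in B would bound row r from above by its value at the vertex.\<close>
    have "\<exists>b\<in>B. \<mu> b > 0"
    proof (rule ccontr)
      assume "\<not> ?thesis"
      then have np: "\<mu> b \<le> 0" if "b \<in> B" for b using that by force
      have "dot n (g r) y = (\<Sum>b\<in>B. \<mu> b * dot n (g b) y)"
        unfolding \<mu>_def by (rule dual_rows_expand_functional[OF W])
      also have "\<dots> \<le> (\<Sum>b\<in>B. \<mu> b * d b)"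
        using np BR y by (intro sum_mono mult_left_mono_neg) (auto simp: feasible_def)
      also have "\<dots> = dot n (g r) ?z" by (simp add: dot_vertex \<mu>_def mult.commute)
      finally show False using viol y rR by (force simp: feasible_def)
    qed
    define S where "S = {b\<in>B. \<mu> b > 0}"
    \<comment> \<open>Ratio test: leaving with the smallest ratio keeps the dual variables nonnegative.\<close>
    define q where "q b = dot n p (?W b) / \<mu> b" for b
    have "finite S" "S \<noteq> {}" using finB \<open>\<exists>b\<in>B. \<mu> b > 0\<close> by (auto simp: S_def)
    then obtain b0 where b0S: "b0 \<in> S" and mini: "\<And>b. b \<in> S \<Longrightarrow> q b0 \<le> q b"
      by (metis arg_min_if_finite(1) arg_min_least)
    have b0: "b0 \<in> B" and \<mu>0: "\<mu> b0 > 0" using b0S by (auto simp: S_def)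
    have q0: "q b0 > 0" using Vpos[OF B b0] \<mu>0 by (simp add: q_def)
    define W' where "W' = pivot n g ?W b0 r"
    let ?B' = "insert r (B - {b0})"
    have W': "dual_rows n g ?B' W'"
      using dual_rows_exchange[OF W b0 rB] \<mu>0 unfolding W'_def \<mu>_def by simp
    have ev: "dot n p (W' b) = (if b = r then dot n p (?W b0) / \<mu> b0
        else dot n p (?W b) - \<mu> b / \<mu> b0 * dot n p (?W b0))" for b
      by (simp add: W'_def dot_pivot \<mu>_def)
    have "dot n p (W' b) \<ge> 0" if b: "b \<in> ?B'" for b
    proof (cases "b = r")
      case True
      then show ?thesis using ev[of b] q0 by (simp add: q_def)
    next
      case False
      then have bB: "b \<in> B" using b by auto
      have eq: "dot n p (W' b) = dot n p (?W b) - \<mu> b * q b0"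
        using ev[of b] \<mu>0 False by (simp add: q_def)
      show ?thesis
      proof (cases "\<mu> b > 0")
        case True
        then have "q b0 \<le> dot n p (?W b) / \<mu> b" using mini[of b] bB by (simp add: S_def q_def)
        then show ?thesis using True by (simp add: eq field_simps)
      next
        case False
        then have "\<mu> b * q b0 \<le> 0" using q0 by (simp add: mult_nonpos_nonneg)
        then show ?thesis using Vpos[OF B bB] by (simp add: eq)
      qed
    qed
    moreover have B'R: "?B' \<subseteq> R" using BR rR by auto
    ultimately have "\<forall>b\<in>?B'. dot n p (W' b) > 0"
      using generic[OF W' B'R] by (metis less_le)
    then have B': "?B' \<in> \<B>" using W' B'R unfolding \<B>_def by blast
    have "val ?B' = dot n p (vertex ?B' W' d)"
      unfolding val_def by (intro dot_cong) (auto simp: vertex_def dual_rows_unique[OF W' V[OF B']])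
    also have "\<dots> = val B + q b0 * (d r - dot n (g r) ?z)"
      using vertex_exchange_value[OF W b0 rB, of p d] \<mu>0 by (simp add: val_def q_def W'_def \<mu>_def)
    also have "\<dots> > val B" using q0 viol by simp
    finally show False using maxi[OF B'] by simp
  qed
  then show ?thesis using that[OF W BR] Vpos[OF B] by blast
qed

text \<open>
Finitely many hyperplanes can be left by an arbitrarily small move, so negative values remain
negative. The hyperplanes are left one at a time, always in the direction of the normal vector
and by so little that every sign which is already nonzero survives.
\<close>

lemma generic_perturbation:
  fixes p :: "nat \<Rightarrow> real"
  assumes fin: "finite \<W>" and nz: "\<And>w. w \<in> \<W> \<Longrightarrow> \<exists>c<n. w c \<noteq> 0"
  obtains p' where "\<And>w. w \<in> \<W> \<Longrightarrow> dot n p' w \<noteq> 0"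
    "\<And>w. w \<in> \<W> \<Longrightarrow> dot n p w < 0 \<Longrightarrow> dot n p' w < 0"
proof -
  have "\<exists>p'. (\<forall>w\<in>\<V>. dot n p' w \<noteq> 0) \<and> (\<forall>w\<in>\<W>. dot n p w \<noteq> 0 \<longrightarrow> sgn (dot n p' w) = sgn (dot n p w))"
    if "finite \<V>" "\<V> \<subseteq> \<W>" for \<V>
    using that
  proof (induction \<V> rule: finite_induct)
    case empty
    show ?case by (intro exI[of _ p]) simp
  next
    case (insert v \<V>)
    then obtain p1 where p1: "\<forall>w\<in>\<V>. dot n p1 w \<noteq> 0"
      "\<forall>w\<in>\<W>. dot n p w \<noteq> 0 \<longrightarrow> sgn (dot n p1 w) = sgn (dot n p w)" by auto
    have v: "dot n v v > 0" using nz[of v] dot_self_pos insert.prems by blast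
    show ?case
    proof (cases "dot n p1 v = 0")
      case False
      then show ?thesis using p1 by (intro exI[of _ p1]) auto
    next
      case True
      define q where "q \<epsilon> c = p1 c + \<epsilon> * v c" for \<epsilon> c
      have dq: "dot n (q \<epsilon>) w = dot n p1 w + \<epsilon> * dot n v w" for \<epsilon> w
        unfolding q_def dot_commute[of n _ w] by (simp only: dot_add_right dot_scale_right)
      have "\<forall>\<^sub>F \<epsilon> in at_right 0. \<forall>w\<in>\<W>. dot n p1 w \<noteq> 0 \<longrightarrow> sgn (dot n (q \<epsilon>) w) = sgn (dot n p1 w)"
      proof (rule eventually_ball_finite[OF fin], rule ballI)
        fix w
        have tend: "((\<lambda>\<epsilon>. dot n (q \<epsilon>) w) \<longlongrightarrow> dot n p1 w) (at_right 0)"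
          unfolding dq by (auto intro!: tendsto_eq_intros)
        consider "dot n p1 w = 0" | "dot n p1 w > 0" | "dot n p1 w < 0" by linarith
        then show "\<forall>\<^sub>F \<epsilon> in at_right 0. dot n p1 w \<noteq> 0 \<longrightarrow> sgn (dot n (q \<epsilon>) w) = sgn (dot n p1 w)"
        proof cases
          case 2
          from order_tendstoD(1)[OF tend 2] show ?thesis by eventually_elim (use 2 in simp)
        next
          case 3
          from order_tendstoD(2)[OF tend 3] show ?thesis by eventually_elim (use 3 in simp)
        qed simp
      qed
      moreover have "\<forall>\<^sub>F \<epsilon>::real in at_right 0. \<epsilon> > 0" by (simp add: eventually_at_right_less)
      ultimately have "\<forall>\<^sub>F \<epsilon> in at_right 0. \<epsilon> > 0 \<and>
          (\<forall>w\<in>\<W>. dot n p1 w \<noteq> 0 \<longrightarrow> sgn (dot n (q \<epsilon>) w) = sgn (dot n p1 w))"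
        by eventually_elim blast
      then obtain \<epsilon> where \<epsilon>: "\<epsilon> > 0"
        "\<And>w. w \<in> \<W> \<Longrightarrow> dot n p1 w \<noteq> 0 \<Longrightarrow> sgn (dot n (q \<epsilon>) w) = sgn (dot n p1 w)"
        using eventually_happens'[OF trivial_limit_at_right_real] by blast
      have "dot n (q \<epsilon>) w \<noteq> 0" if "w \<in> insert v \<V>" for w
      proof (cases "w = v")
        case True
        then show ?thesis using \<open>dot n p1 v = 0\<close> \<epsilon>(1) v by (simp add: dq)
      next
        case False
        then have "w \<in> \<V>" "w \<in> \<W>" using that insert.prems by auto
        then show ?thesis using \<epsilon>(2)[of w] p1(1) by (metis sgn_zero_iff)
      qed
      moreover have "sgn (dot n (q \<epsilon>) w) = sgn (dot n p w)" if "w \<in> \<W>" "dot n p w \<noteq> 0" for w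
        using \<epsilon>(2)[of w] p1(2) that by (metis sgn_zero_iff)
      ultimately show ?thesis by blast
    qed
  qed
  from this[OF fin order_refl] obtain p' where p': "\<forall>w\<in>\<W>. dot n p' w \<noteq> 0"
    "\<forall>w\<in>\<W>. dot n p w \<noteq> 0 \<longrightarrow> sgn (dot n p' w) = sgn (dot n p w)" by blast
  have "dot n p' w < 0" if "w \<in> \<W>" "dot n p w < 0" for w
    using p'(2) that by (metis sgn_less less_irrefl)
  then show ?thesis using that p'(1) by blast
qed

section \<open>Passing along a segment of data\<close>

text \<open>
A Lipschitz estimate that holds inside each of finitely many closed sets extends to the interval
that they cover: starting in a set \<open>S\<close> containing the left end point, jump to the last point
\<open>c\<close> of \<open>S\<close>. What remains to the right of \<open>c\<close> is covered by the other sets, and so is \<open>c\<close> itself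
because their union is closed.
\<close>

lemma lipschitz_along_closed_cover:
  fixes D :: "real \<Rightarrow> real \<Rightarrow> real"
  assumes "finite \<S>" "\<And>S. S \<in> \<S> \<Longrightarrow> closed S" "{a..b} \<subseteq> \<Union>\<S>" "a \<le> b"
    and tri: "\<And>r s t. D r t \<le> D r s + D s t"
    and lip: "\<And>S s t. S \<in> \<S> \<Longrightarrow> s \<in> S \<Longrightarrow> t \<in> S \<Longrightarrow> s \<le> t \<Longrightarrow> D s t \<le> L * (t - s)"
  shows "D a b \<le> L * (b - a)"
  using assms(1-4) lip
proof (induction \<S> arbitrary: a rule: finite_psubset_induct)
  case (psubset \<S>)
  then obtain S where S: "S \<in> \<S>" "a \<in> S" by auto
  have "compact (S \<inter> {a..b})" using psubset.prems(1)[OF S(1)] by (simp add: closed_Int_compact)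
  moreover have "a \<in> S \<inter> {a..b}" using S psubset.prems(3) by simp
  ultimately obtain c where c: "c \<in> S" "a \<le> c" "c \<le> b" and max: "\<And>s. s \<in> S \<inter> {a..b} \<Longrightarrow> s \<le> c"
    using compact_attains_sup[of "S \<inter> {a..b}"] by (metis IntE atLeastAtMost_iff empty_iff)
  have ac: "D a c \<le> L * (c - a)" using psubset.prems(4)[OF S(1,2) c(1,2)] .
  show ?case
  proof (cases "c = b")
    case True
    then show ?thesis using ac by simp
  next
    case False
    then have "c < b" using c by simp
    have sub: "{c<..b} \<subseteq> \<Union>(\<S> - {S})"
    proof
      fix s assume s: "s \<in> {c<..b}"
      then have "s \<in> {a..b}" "s \<notin> S" using c max[of s] by auto
      then show "s \<in> \<Union>(\<S> - {S})" using psubset.prems(2) by auto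
    qed
    have "closed (\<Union>(\<S> - {S}))" using psubset.prems(1) psubset.hyps by (intro closed_Union) auto
    then have "closure {c<..b} \<subseteq> \<Union>(\<S> - {S})" using sub by (intro closure_minimal)
    then have cov: "{c..b} \<subseteq> \<Union>(\<S> - {S})" using \<open>c < b\<close> by simp
    have "D c b \<le> L * (b - c)"
      using S(1) psubset.prems(1,4) cov c(3) by (intro psubset.IH[of "\<S> - {S}"]) auto
    then show ?thesis using ac tri[of a b c] by (simp add: right_diff_distrib)
  qed
qed

section \<open>Extremal values of a quadratic form\<close>

text \<open>
Vectors are functions on all of \<open>nat\<close>; fixing them to be zero from \<open>n\<close> on places the
unit sphere inside a product of compact sets, so Tychonoff's theorem applies.
\<close>

lemma compact_unit_sphere: "compact {x::nat \<Rightarrow> real. (\<forall>c\<ge>n. x c = 0) \<and> dot n x x = 1}"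
  (is "compact ?S")
proof -
  define K where "K = (\<lambda>c. if c < n then {-1..1::real} else {0})"
  have "compact (K c)" for c by (simp add: K_def)
  then have "compactin (product_topology (\<lambda>_. euclidean) UNIV) (PiE UNIV K)"
    by (subst compactin_PiE) simp
  then have compact: "compact (PiE UNIV K)" by (simp add: euclidean_product_topology)
  have closed: "closed {x::nat \<Rightarrow> real. dot n x x = 1}"
    unfolding dot_def by (intro closed_Collect_eq continuous_intros continuous_on_product_coordinates)
  have "?S = PiE UNIV K \<inter> {x. dot n x x = 1}"
  proof (intro equalityI subsetI)
    fix x assume x: "x \<in> ?S"
    have "x c \<in> K c" for c
    proof (cases "c < n")
      case True
      then have "(x c)\<^sup>2 \<le> dot n x x"
        unfolding dot_def power2_eq_square by (intro member_le_sum) auto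
      then have "\<bar>x c\<bar> \<le> 1" using x by (simp add: abs_square_le_1)
      then show ?thesis using True by (simp add: K_def abs_le_iff minus_le_iff)
    qed (use x in \<open>simp add: K_def\<close>)
    then show "x \<in> PiE UNIV K \<inter> {x. dot n x x = 1}" using x by (simp add: PiE_UNIV_domain)
  next
    fix x assume x: "x \<in> PiE UNIV K \<inter> {x. dot n x x = 1}"
    then have "x c \<in> K c" for c by (simp add: PiE_UNIV_domain Pi_iff)
    then have "x c = 0" if "c \<ge> n" for c using that by (simp add: K_def) (metis not_less singletonD)
    then show "x \<in> ?S" using x by simp
  qed
  then show ?thesis using compact_Int_closed[OF compact closed] by (simp only:)
qed

text \<open>
The Rayleigh principle: a maximiser \<open>x\<close> of the form on the unit sphere is an eigenvector. With
\<open>\<mu>\<close> the maximum, \<open>P y = \<mu> |y|\<^sup>2 - y \<bullet> H y\<close> is nonnegative and vanishes at \<open>x\<close>; were the residual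
\<open>e = H x - \<mu> x\<close> nonzero, a small step from \<open>x\<close> along \<open>e\<close> would make \<open>P\<close> negative.
\<close>

lemma quadratic_form_max:
  assumes sym: "\<And>c c'. c < n \<Longrightarrow> c' < n \<Longrightarrow> h c c' = h c' c" and n: "n \<ge> 1"
  obtains x \<mu> where "dot n x x = 1" "\<And>c. c < n \<Longrightarrow> dot n (h c) x = \<mu> * x c"
    "\<And>y. dot n y (\<lambda>c. dot n (h c) y) \<le> \<mu> * dot n y y"
proof -
  define S where "S = {x::nat \<Rightarrow> real. (\<forall>c\<ge>n. x c = 0) \<and> dot n x x = 1}"
  define H where "H y = (\<lambda>c. dot n (h c) y)" for y
  have H_lin: "H (\<lambda>c. u c + t * v c) = (\<lambda>c. H u c + t * H v c)" for u t v
    by (simp only: H_def dot_add_right dot_scale_right)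
  have H_sym: "dot n u (H v) = dot n v (H u)" for u v
    unfolding H_def dot_def sum_distrib_left
    by (subst sum.swap) (auto intro!: sum.cong simp: sym mult_ac)
  have "(\<lambda>c. if c = 0 then 1 else 0) \<in> S"
    using n by (auto simp: S_def dot_def if_distrib[of "\<lambda>x. x * _"] cong: if_cong)
  then have "S \<noteq> {}" by blast
  moreover have "continuous_on UNIV (\<lambda>y. dot n y (H y))"
    unfolding dot_def H_def by (intro continuous_intros continuous_on_product_coordinates)
  then have "continuous_on S (\<lambda>y. dot n y (H y))" by (rule continuous_on_subset) simp
  ultimately obtain x where x: "x \<in> S" and max: "\<And>y. y \<in> S \<Longrightarrow> dot n y (H y) \<le> dot n x (H x)"
    using continuous_attains_sup[of S "\<lambda>y. dot n y (H y)"] compact_unit_sphere[of n] unfolding S_def by blast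
  define \<mu> where "\<mu> = dot n x (H x)"
  have x1: "dot n x x = 1" using x by (simp add: S_def)
  have bound: "dot n y (H y) \<le> \<mu> * dot n y y" for y
  proof (cases "dot n y y = 0")
    case True
    then have "\<forall>c<n. y c = 0" using dot_self_pos[of _ n y] by force
    then show ?thesis by (simp add: dot_def)
  next
    case False
    define k where "k = dot n y y"
    have "k \<ge> 0" unfolding k_def dot_self by simp
    then have k: "k > 0" using False by (simp add: k_def)
    define y' where "y' = (\<lambda>c. if c < n then 1 / sqrt k * y c else 0)"
    have H': "H y' = (\<lambda>c. 1 / sqrt k * H y c)"
    proof
      fix c
      have "H y' c = dot n (h c) (\<lambda>c. 1 / sqrt k * y c)"
        unfolding H_def by (intro dot_cong) (auto simp: y'_def)
      then show "H y' c = 1 / sqrt k * H y c" by (simp only: dot_scale_right H_def)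
    qed
    have scale: "dot n y' (\<lambda>c. 1 / sqrt k * v c) = 1 / k * dot n y v" for v
    proof -
      have "dot n y' (\<lambda>c. 1 / sqrt k * v c) = dot n (\<lambda>c. 1 / sqrt k * y c) (\<lambda>c. 1 / sqrt k * v c)"
        by (intro dot_cong) (auto simp: y'_def)
      also have "\<dots> = 1 / sqrt k * (1 / sqrt k * dot n y v)"
        by (simp only: dot_scale_right dot_commute[of n _ v])
      finally show ?thesis using k by simp
    qed
    have "dot n y' y' = dot n y' (\<lambda>c. 1 / sqrt k * y c)" by (intro dot_cong) (auto simp: y'_def)
    then have "y' \<in> S" using k by (simp only: scale S_def) (simp add: y'_def flip: k_def)
    then have "dot n y' (H y') \<le> \<mu>" unfolding \<mu>_def by (rule max)
    then have "1 / k * dot n y (H y) \<le> \<mu>" using scale[of "H y"] by (simp only: H')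
    then show ?thesis using k by (simp add: field_simps flip: k_def)
  qed
  define P where "P y = \<mu> * dot n y y - dot n y (H y)" for y
  have P: "P y \<ge> 0" for y using bound[of y] by (simp add: P_def)
  define e where "e = (\<lambda>c. H x c + (- \<mu>) * x c)"
  have "P (\<lambda>c. x c + t * e c) = t * (t * P e - 2 * dot n e e)" for t
  proof -
    have xe: "dot n e e = dot n e (H x) - \<mu> * dot n e x"
      using dot_add_right[of n e "H x" "\<lambda>c. (-\<mu>) * x c"] dot_scale_right[of n e "-\<mu>" x]
      by (simp add: e_def)
    have "dot n (\<lambda>c. x c + t * e c) (\<lambda>c. x c + t * e c) = dot n x x + 2 * t * dot n e x + t * t * dot n e e"
      by (simp only: dot_add_right dot_scale_right dot_commute[of n "\<lambda>c. x c + t * e c"])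
        (simp add: dot_commute[of n x e] algebra_simps)
    moreover have "dot n (\<lambda>c. x c + t * e c) (H (\<lambda>c. x c + t * e c))
        = dot n x (H x) + 2 * t * dot n e (H x) + t * t * dot n e (H e)"
      unfolding H_lin
      by (simp only: dot_add_right dot_scale_right dot_commute[of n "\<lambda>c. x c + t * e c"])
        (simp add: dot_commute[of n "H _"] H_sym[of x e] algebra_simps)
    ultimately show ?thesis using x1
      by (simp add: P_def xe \<mu>_def[symmetric]) (simp add: algebra_simps)
  qed
  note expand = this
  have "dot n e e = 0"
  proof (rule ccontr)
    assume "dot n e e \<noteq> 0"
    moreover have "dot n e e \<ge> 0" by (simp add: dot_self)
    ultimately have pos: "dot n e e > 0" by simp
    define t where "t = dot n e e / (P e + 1)"
    have "t > 0" using pos P[of e] by (simp add: t_def)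
    moreover have "t * P e \<le> dot n e e"
      using pos P[of e] by (simp add: t_def field_simps)
    ultimately have "t * (t * P e - 2 * dot n e e) < 0" using pos by (intro mult_pos_neg) auto
    then show False using P[of "\<lambda>c. x c + t * e c"] expand[of t] by simp
  qed
  then have "e c = 0" if "c < n" for c using that dot_self_pos[of c n e] by force
  then have "dot n (h c) x = \<mu> * x c" if "c < n" for c using that by (force simp: e_def H_def)
  then show ?thesis using that x1 bound unfolding H_def by blast
qed

section \<open>Decay of the solution of a banded linear system\<close>

text \<open>
For a self-adjoint map the operator norm is the supremum of the absolute value of its quadratic
form on the unit sphere. The parallelogram identity is applied to \<open>t x\<close> and \<open>s K x\<close>, which are scaled to equal
length.
\<close>

lemma polarization_bound:
  fixes K :: "(nat \<Rightarrow> real) \<Rightarrow> nat \<Rightarrow> real"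
  assumes add: "\<And>u v s t. K (\<lambda>c. s * u c + t * v c) = (\<lambda>c. s * K u c + t * K v c)"
    and sym: "\<And>u v. dot n u (K v) = dot n v (K u)"
    and form: "\<And>u. \<bar>dot n u (K u)\<bar> \<le> \<rho> * dot n u u"
  shows "L2_set (K x) {..<n} \<le> \<rho> * L2_set x {..<n}"
proof (cases "L2_set (K x) {..<n} = 0 \<or> L2_set x {..<n} = 0")
  case True
  have "L2_set (K x) {..<n} = 0"
  proof (cases "L2_set x {..<n} = 0")
    case True
    then have x0: "\<forall>c<n. x c = 0" by (simp add: L2_set_eq_0_iff)
    have "dot n (K x) (K x) = dot n x (K (K x))" by (rule sym)
    also have "\<dots> = 0" using x0 by (simp add: dot_def)
    finally show ?thesis by (simp add: dot_self)
  qed (use True in auto)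
  moreover have "\<rho> * L2_set x {..<n} \<ge> 0"
  proof (cases "L2_set x {..<n} = 0")
    case False
    then have "0 \<le> \<rho> * (L2_set x {..<n})\<^sup>2" "0 < L2_set x {..<n}"
      using form[of x] L2_set_nonneg[of x "{..<n}"] by (auto simp flip: dot_self simp: less_le)
    then show ?thesis by (simp add: zero_le_mult_iff)
  qed simp
  ultimately show ?thesis by simp
next
  case False
  define s t where "s = L2_set x {..<n}" and "t = L2_set (K x) {..<n}"
  have st: "s > 0" "t > 0" using False by (simp_all add: s_def t_def less_le)
  define y where "y = K x"
  have ss: "dot n x x = s * s" and tt: "dot n y y = t * t" and xy: "dot n x (K y) = t * t"
    using sym[of x y] by (simp_all add: dot_self s_def t_def y_def power2_eq_square)
  have dot2: "dot n (\<lambda>c. a * u c + b * v c) w = a * dot n u w + b * dot n v w" for a b u v w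
    unfolding dot_commute[of n _ w] by (simp only: dot_add_right dot_scale_right)
  have dot2': "dot n w (\<lambda>c. a * u c + b * v c) = a * dot n w u + b * dot n w v" for a b u v w
    by (simp only: dot_add_right dot_scale_right)
  let ?u = "\<lambda>c. t * x c + s * y c" and ?v = "\<lambda>c. t * x c + (- s) * y c"
  have "dot n ?u (K ?u) - dot n ?v (K ?v) = 4 * (t * s * dot n x (K y))"
    unfolding add dot2 dot2' sym[of y x] by (simp add: algebra_simps)
  moreover have "dot n ?u ?u + dot n ?v ?v = 4 * ((s * t) * (s * t))"
    unfolding dot2 dot2' ss tt by (simp add: algebra_simps)
  ultimately have "4 * (t * s * (t * t)) \<le> \<rho> * (4 * ((s * t) * (s * t)))"
    using form[of ?u] form[of ?v] unfolding xy by (smt (verit) distrib_left)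
  then have "(t * s * t) * t \<le> (t * s * t) * (\<rho> * s)" by (simp add: mult_ac)
  then show ?thesis using st unfolding s_def[symmetric] t_def[symmetric] by simp
qed

text \<open>
The map \<open>x \<mapsto> x - \<gamma> M\<^sup>T M x\<close> for the matrix \<open>M\<close> with rows \<open>g b\<close>, \<open>b \<in> B\<close>: the error propagation
of the Richardson iteration for the normal equations.
\<close>

definition richardson ::
  "nat \<Rightarrow> (nat \<Rightarrow> nat \<Rightarrow> real) \<Rightarrow> nat set \<Rightarrow> real \<Rightarrow> (nat \<Rightarrow> real) \<Rightarrow> nat \<Rightarrow> real" where
  "richardson n g B \<gamma> x c = x c - \<gamma> * (\<Sum>b\<in>B. dot n (g b) x * g b c)"

text \<open>
The step size \<open>2 / (\<alpha>\<^sup>2 + \<beta>\<^sup>2)\<close> maps the spectrum of \<open>M\<^sup>T M\<close>, contained in \<open>[\<alpha>\<^sup>2, \<beta>\<^sup>2]\<close>,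
into a symmetric interval around zero; its half-length is the contraction factor.
\<close>

lemma richardson_contraction:
  assumes "0 < \<alpha>"
    and lower: "\<And>x. \<alpha>\<^sup>2 * dot n x x \<le> (\<Sum>b\<in>B. (dot n (g b) x)\<^sup>2)"
    and upper: "\<And>x. (\<Sum>b\<in>B. (dot n (g b) x)\<^sup>2) \<le> \<beta>\<^sup>2 * dot n x x"
  shows "L2_set (richardson n g B (2 / (\<alpha>\<^sup>2 + \<beta>\<^sup>2)) x) {..<n}
     \<le> (\<beta>\<^sup>2 - \<alpha>\<^sup>2) / (\<beta>\<^sup>2 + \<alpha>\<^sup>2) * L2_set x {..<n}"
proof (rule polarization_bound)
  define \<gamma> where "\<gamma> = 2 / (\<alpha>\<^sup>2 + \<beta>\<^sup>2)"
  have s: "\<alpha>\<^sup>2 + \<beta>\<^sup>2 > 0" using \<open>0 < \<alpha>\<close> by (simp add: add_pos_nonneg)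
  then have "\<gamma> > 0" by (simp add: \<gamma>_def)
  have form: "dot n v (richardson n g B \<gamma> u) = dot n v u - \<gamma> * (\<Sum>b\<in>B. dot n (g b) u * dot n (g b) v)" for u v
    unfolding richardson_def by (simp only: dot_diff_right dot_scale_right dot_sum_right dot_commute[of n v "g _"])
  fix u v s t
  show "richardson n g B \<gamma> (\<lambda>c. s * u c + t * v c)
      = (\<lambda>c. s * richardson n g B \<gamma> u c + t * richardson n g B \<gamma> v c)"
    unfolding richardson_def dot_add_right dot_scale_right
    by (simp add: algebra_simps sum.distrib sum_distrib_left)
  show "dot n u (richardson n g B \<gamma> v) = dot n v (richardson n g B \<gamma> u)"
    unfolding form by (simp add: dot_commute[of n u v] mult.commute)
  have eq: "dot n u (richardson n g B \<gamma> u) = dot n u u - \<gamma> * (\<Sum>b\<in>B. (dot n (g b) u)\<^sup>2)"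
    unfolding form by (simp add: power2_eq_square)
  have "\<gamma> * (\<alpha>\<^sup>2 * dot n u u) \<le> \<gamma> * (\<Sum>b\<in>B. (dot n (g b) u)\<^sup>2)"
    "\<gamma> * (\<Sum>b\<in>B. (dot n (g b) u)\<^sup>2) \<le> \<gamma> * (\<beta>\<^sup>2 * dot n u u)"
    using lower[of u] upper[of u] \<open>\<gamma> > 0\<close> by (simp_all add: mult_left_mono)
  moreover have "dot n u u - \<gamma> * (\<alpha>\<^sup>2 * dot n u u) = (\<beta>\<^sup>2 - \<alpha>\<^sup>2) / (\<beta>\<^sup>2 + \<alpha>\<^sup>2) * dot n u u"
    "dot n u u - \<gamma> * (\<beta>\<^sup>2 * dot n u u) = - ((\<beta>\<^sup>2 - \<alpha>\<^sup>2) / (\<beta>\<^sup>2 + \<alpha>\<^sup>2) * dot n u u)"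
    using s \<open>0 < \<alpha>\<close> by (simp_all add: \<gamma>_def divide_simps) (simp_all add: algebra_simps)
  ultimately show "\<bar>dot n u (richardson n g B \<gamma> u)\<bar> \<le> (\<beta>\<^sup>2 - \<alpha>\<^sup>2) / (\<beta>\<^sup>2 + \<alpha>\<^sup>2) * dot n u u"
    unfolding eq by (simp only: abs_le_iff) linarith
qed

text \<open>
One application of the map carries information only between adjacent column blocks. If the right
hand side \<open>M x\<close> lives in row block \<open>j\<close>, then a step that uses the true values of \<open>x\<close> changes
\<open>x\<close> only in the column blocks \<open>j - 1\<close> and \<open>j\<close>, because elsewhere the residual
is zero. So after \<open>q\<close> steps the entries at distance at least \<open>q\<close> from these two
blocks still have their initial values.
\<close>

lemma richardson_iterate_local:
  fixes g :: "nat \<Rightarrow> nat \<Rightarrow> real"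
  assumes band: "\<And>b c. b \<in> B \<Longrightarrow> c < n \<Longrightarrow> g b c \<noteq> 0 \<Longrightarrow> cb c = rb b \<or> Suc (cb c) = rb b"
    and supp: "\<And>b. b \<in> B \<Longrightarrow> rb b \<noteq> j \<Longrightarrow> dot n (g b) x = 0"
    and c: "c < n" and far: "q = 0 \<or> int q + 1 \<le> \<bar>int (cb c) - int j\<bar>"
  shows "(richardson n g B \<gamma> ^^ q) x c = x c"
  using c far
proof (induction q arbitrary: c)
  case (Suc q)
  let ?v = "(richardson n g B \<gamma> ^^ q) x"
  have "dot n (g b) ?v * g b c = 0" if b: "b \<in> B" for b
  proof (cases "g b c = 0")
    case False
    then have bc: "cb c = rb b \<or> Suc (cb c) = rb b" using band b Suc.prems by auto
    have "g b c' * ?v c' = g b c' * x c'" if "c' < n" for c'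
    proof (cases "g b c' = 0")
      case False
      then have "cb c' = rb b \<or> Suc (cb c') = rb b" using band b that by auto
      then have "int q + 1 \<le> \<bar>int (cb c') - int j\<bar>" using bc Suc.prems(2) by auto
      then show ?thesis using Suc.IH[of c'] that by simp
    qed simp
    then have "dot n (g b) ?v = dot n (g b) x"
      unfolding dot_def by (intro sum.cong) (auto simp only: lessThan_iff)
    also have "\<dots> = 0" using bc Suc.prems by (intro supp[OF b]) auto
    finally show ?thesis by simp
  qed simp
  then have zero: "(\<Sum>b\<in>B. dot n (g b) ?v * g b c) = 0" by (intro sum.neutral) blast
  have "(richardson n g B \<gamma> ^^ Suc q) x c = ?v c"
    by (simp add: richardson_def[of n g B \<gamma> ?v c] zero)
  then show ?case using Suc.IH[of c] Suc.prems by auto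
qed simp

text \<open>
The entries of \<open>x\<close> in column block \<open>i\<close> agree with those of the \<open>q\<close>-th iterate, where \<open>q\<close> is
the distance from \<open>i\<close> to \<open>{j - 1, j}\<close> or less, and that iterate is small as a whole. So a
single power of the contraction replaces the tail of the Neumann series.
\<close>

lemma block_decay:
  fixes g :: "nat \<Rightarrow> nat \<Rightarrow> real"
  assumes "0 < \<alpha>" "\<alpha> \<le> \<beta>"
    and lower: "\<And>x. \<alpha>\<^sup>2 * dot n x x \<le> (\<Sum>b\<in>B. (dot n (g b) x)\<^sup>2)"
    and upper: "\<And>x. (\<Sum>b\<in>B. (dot n (g b) x)\<^sup>2) \<le> \<beta>\<^sup>2 * dot n x x"
    and band: "\<And>b c. b \<in> B \<Longrightarrow> c < n \<Longrightarrow> g b c \<noteq> 0 \<Longrightarrow> cb c = rb b \<or> Suc (cb c) = rb b"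
    and supp: "\<And>b. b \<in> B \<Longrightarrow> rb b \<noteq> j \<Longrightarrow> dot n (g b) x = 0"
  shows "L2_set x {c. c < n \<and> cb c = i}
     \<le> ((\<beta>\<^sup>2 - \<alpha>\<^sup>2) / (\<beta>\<^sup>2 + \<alpha>\<^sup>2)) ^ nat (\<bar>int i - int j\<bar> - 1)
        * (L2_set (\<lambda>b. dot n (g b) x) B / \<alpha>)"
proof -
  define K where "K = richardson n g B (2 / (\<alpha>\<^sup>2 + \<beta>\<^sup>2))"
  define \<rho> where "\<rho> = (\<beta>\<^sup>2 - \<alpha>\<^sup>2) / (\<beta>\<^sup>2 + \<alpha>\<^sup>2)"
  define q where "q = nat (\<bar>int i - int j\<bar> - 1)"
  have "\<alpha>\<^sup>2 \<le> \<beta>\<^sup>2" using assms(1,2) by (simp add: power_mono)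
  then have \<rho>: "0 \<le> \<rho>" by (simp add: \<rho>_def)
  have iter: "L2_set ((K ^^ k) x) {..<n} \<le> \<rho> ^ k * L2_set x {..<n}" for k
  proof (induction k)
    case (Suc k)
    have "L2_set ((K ^^ Suc k) x) {..<n} \<le> \<rho> * L2_set ((K ^^ k) x) {..<n}"
      using richardson_contraction[OF \<open>0 < \<alpha>\<close> lower upper] by (simp add: K_def \<rho>_def)
    also have "\<dots> \<le> \<rho> * (\<rho> ^ k * L2_set x {..<n})" using Suc.IH \<rho> by (rule mult_left_mono)
    finally show ?case by simp
  qed simp
  have "L2_set x {c. c < n \<and> cb c = i} = L2_set ((K ^^ q) x) {c. c < n \<and> cb c = i}"
    unfolding K_def
    by (intro L2_set_cong refl richardson_iterate_local[of B n g cb rb j, OF band supp, symmetric])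
      (auto simp: q_def)
  also have "\<dots> \<le> L2_set ((K ^^ q) x) {..<n}"
    unfolding L2_set_def by (intro real_sqrt_le_mono sum_mono2) auto
  also have "\<dots> \<le> \<rho> ^ q * L2_set x {..<n}" by (rule iter)
  also have "L2_set x {..<n} \<le> L2_set (\<lambda>b. dot n (g b) x) B / \<alpha>"
  proof -
    have "(\<alpha> * L2_set x {..<n})\<^sup>2 \<le> (L2_set (\<lambda>b. dot n (g b) x) B)\<^sup>2"
      using lower[of x] by (simp add: power_mult_distrib dot_self) (simp add: L2_set_def sum_nonneg)
    then have "\<alpha> * L2_set x {..<n} \<le> L2_set (\<lambda>b. dot n (g b) x) B"
      by (rule power2_le_imp_le) simp
    then show ?thesis using \<open>0 < \<alpha>\<close> by (simp add: field_simps)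
  qed
  finally show ?thesis using \<rho> by (simp add: mult_left_mono \<rho>_def q_def)
qed

lemma L2_set_sum_le: "L2_set (\<lambda>c. \<Sum>j\<in>J. f j c) S \<le> (\<Sum>j\<in>J. L2_set (f j) S)"
proof (induction J rule: infinite_finite_induct)
  case (insert j J)
  have "L2_set (\<lambda>c. f j c + (\<Sum>j\<in>J. f j c)) S \<le> L2_set (f j) S + L2_set (\<lambda>c. \<Sum>j\<in>J. f j c) S"
    by (rule L2_set_triangle_ineq)
  then show ?case using insert by simp
qed (simp_all add: L2_set_def)

lemma block_decay_superposition:
  assumes W: "dual_rows n g B W" and "0 < \<alpha>" "\<alpha> \<le> \<beta>"
    and lower: "\<And>x. \<alpha>\<^sup>2 * dot n x x \<le> (\<Sum>b\<in>B. (dot n (g b) x)\<^sup>2)"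
    and upper: "\<And>x. (\<Sum>b\<in>B. (dot n (g b) x)\<^sup>2) \<le> \<beta>\<^sup>2 * dot n x x"
    and band: "\<And>b c. b \<in> B \<Longrightarrow> c < n \<Longrightarrow> g b c \<noteq> 0 \<Longrightarrow> cb c = rb b \<or> Suc (cb c) = rb b"
    and rb: "finite J" "rb ` B \<subseteq> J"
  shows "L2_set (vertex B W y) {c. c < n \<and> cb c = i}
     \<le> (\<Sum>j\<in>J. ((\<beta>\<^sup>2 - \<alpha>\<^sup>2) / (\<beta>\<^sup>2 + \<alpha>\<^sup>2)) ^ nat (\<bar>int i - int j\<bar> - 1)
           * (L2_set y {b\<in>B. rb b = j} / \<alpha>))"
proof -
  define yj where "yj j b = (if rb b = j then y b else 0)" for j b
  have fin: "finite B" using W by (simp add: dual_rows_def)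
  have norm_yj: "L2_set (\<lambda>b. dot n (g b) (vertex B W (yj j))) B = L2_set y {b\<in>B. rb b = j}" for j
  proof -
    have "(\<Sum>b\<in>B. (dot n (g b) (vertex B W (yj j)))\<^sup>2) = (\<Sum>b\<in>B. if rb b = j then (y b)\<^sup>2 else 0)"
      using row_vertex[OF W] by (intro sum.cong) (auto simp: yj_def)
    also have "\<dots> = (\<Sum>b\<in>{b\<in>B. rb b = j}. (y b)\<^sup>2)" using fin by (simp add: sum.inter_filter)
    finally show ?thesis by (simp add: L2_set_def)
  qed
  have "(\<Sum>j\<in>J. yj j b) = y b" if "b \<in> B" for b
    using rb that by (auto simp: yj_def)
  then have "vertex B W y = (\<lambda>c. \<Sum>j\<in>J. vertex B W (yj j) c)"
    unfolding vertex_def by (subst sum.swap) (simp flip: sum_distrib_right)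
  then have "L2_set (vertex B W y) {c. c < n \<and> cb c = i}
      \<le> (\<Sum>j\<in>J. L2_set (vertex B W (yj j)) {c. c < n \<and> cb c = i})"
    by (simp only: L2_set_sum_le)
  also have "\<dots> \<le> (\<Sum>j\<in>J. ((\<beta>\<^sup>2 - \<alpha>\<^sup>2) / (\<beta>\<^sup>2 + \<alpha>\<^sup>2)) ^ nat (\<bar>int i - int j\<bar> - 1)
           * (L2_set (\<lambda>b. dot n (g b) (vertex B W (yj j))) B / \<alpha>))"
    using assms(2-5) band
    by (intro sum_mono block_decay[where rb = rb]) (auto simp: row_vertex[OF W] yj_def)
  finally show ?thesis by (simp only: norm_yj)
qed

section \<open>Matrices, bases and singular values\<close>

text \<open>
The rows of a matrix as functions of the column index: the form in which matrices enter
the index-free linear algebra of the preceding sections.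
\<close>

definition entry_rows :: "real mat \<Rightarrow> nat \<Rightarrow> nat \<Rightarrow> real" where
  "entry_rows G r c = G $$ (r, c)"

lemma bij_betw_pick:
  assumes "finite B"
  shows "bij_betw (pick B) {..<card B} B"
proof -
  have "inj_on (pick B) {..<card B}"
    by (rule inj_onI) (metis card_pick_le lessThan_iff)
  moreover have "pick B ` {..<card B} \<subseteq> B" using pick_in_set_le by auto
  ultimately show ?thesis
    using assms by (metis bij_betw_def card_image card_lessThan card_subset_eq)
qed

lemma row_submatrix_eq:
  assumes "B \<subseteq> {..<dim_row G}"
  shows "row_submatrix G B = mat (card B) (dim_col G) (\<lambda>(k, c). entry_rows G (pick B k) c)"
proof -
  have "{i. i < dim_row G \<and> i \<in> B} = B" using assms by auto
  then show ?thesis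
    by (intro eq_matI) (simp_all add: row_submatrix_def submatrix_def entry_rows_def pick_UNIV)
qed

text \<open>
The link between bases as invertible submatrices and the index-free inverse. In the direction
from right to left, the trace identity \<open>card B = \<Sum>b\<in>B. \<Sum>c<n. g b c * W b c = n\<close> shows
that the submatrix is square.
\<close>

lemma lp_basis_iff_dual_rows:
  "lp_basis G B \<longleftrightarrow> B \<subseteq> {..<dim_row G} \<and> (\<exists>W. dual_rows (dim_col G) (entry_rows G) B W)"
proof -
  define n g where "n = dim_col G" and "g = entry_rows G"
  have "invertible_mat (row_submatrix G B) \<longleftrightarrow> (\<exists>W. dual_rows n g B W)" if BR: "B \<subseteq> {..<dim_row G}"
  proof -
    have finB: "finite B" using BR finite_subset by blast
    define M where "M = mat (card B) n (\<lambda>(k, c). g (pick B k) c)"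
    have M: "row_submatrix G B = M" using row_submatrix_eq[OF BR] by (simp add: M_def n_def g_def)
    note bij = bij_betw_pick[OF finB]
    show ?thesis unfolding M
    proof
      assume "invertible_mat M"
      then obtain V where card: "card B = n" and MV: "M * V = 1\<^sub>m n" and VM: "V * M = 1\<^sub>m (dim_row V)"
        by (auto simp: invertible_mat_def inverts_mat_def M_def)
      have "dim_col V = n" using MV by (metis index_mult_mat(3) index_one_mat(3))
      moreover have "dim_row V = n" using VM by (metis M_def dim_col_mat(1) index_mult_mat(3) index_one_mat(3))
      ultimately have V: "V \<in> carrier_mat n n" by auto
      define k where "k = the_inv_into {..<card B} (pick B)"
      have k: "k (pick B l) = l" if "l < n" for l
        using bij that card by (simp add: k_def bij_betw_def the_inv_into_f_f)
      define W where "W b c = V $$ (c, k b)" for b c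
      have MV_entry: "(M * V) $$ (l, l') = dot n (g (pick B l)) (W (pick B l'))" if "l < n" "l' < n" for l l'
        using that V card
        by (simp add: M_def dot_def scalar_prod_def W_def k lessThan_atLeast0)
      have gW: "dot n (g (pick B l)) (W (pick B l')) = of_bool (l = l')" if "l < n" "l' < n" for l l'
        using MV_entry[OF that] that unfolding MV by (simp split: if_splits)
      have img: "\<exists>l<n. b = pick B l" if "b \<in> B" for b
      proof -
        have "b \<in> pick B ` {..<n}" using that bij card by (simp add: bij_betw_def)
        then show ?thesis by blast
      qed
      have 1: "dot n (g a) (W b) = of_bool (a = b)" if ab: "a \<in> B" "b \<in> B" for a b
      proof -
        obtain l l' where l: "a = pick B l" "b = pick B l'" "l < n" "l' < n"
          using img[OF ab(1)] img[OF ab(2)] by blast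
        then have "(a = b) = (l = l')" by (metis k)
        then show ?thesis using gW l by simp
      qed
      have 2: "(\<Sum>b\<in>B. W b c * g b c') = of_bool (c = c')" if c: "c < n" "c' < n" for c c'
      proof -
        have "(\<Sum>b\<in>B. W b c * g b c') = (\<Sum>l<n. W (pick B l) c * g (pick B l) c')"
          using sum.reindex_bij_betw[OF bij, of "\<lambda>b. W b c * g b c'"] card by simp
        also have "\<dots> = (V * M) $$ (c, c')"
          using c V card by (simp add: M_def scalar_prod_def W_def k lessThan_atLeast0)
        finally show ?thesis using VM V c by simp
      qed
      show "\<exists>W. dual_rows n g B W" unfolding dual_rows_def using 1 2 finB by blast
    next
      assume "\<exists>W. dual_rows n g B W"
      then obtain W where W: "dual_rows n g B W" by blast
      have "real (card B) = (\<Sum>b\<in>B. \<Sum>c<n. g b c * W b c)"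
        using W by (simp add: dual_rows_def dot_def)
      also have "\<dots> = (\<Sum>c<n. \<Sum>b\<in>B. W b c * g b c)" by (subst sum.swap) (simp add: mult.commute)
      also have "\<dots> = real n" using W by (simp add: dual_rows_def)
      finally have card: "card B = n" by simp
      define V where "V = mat n n (\<lambda>(c, k). W (pick B k) c)"
      have "M * V = 1\<^sub>m n"
      proof (rule eq_matI)
        fix l l' assume "l < dim_row (1\<^sub>m n :: real mat)" "l' < dim_col (1\<^sub>m n :: real mat)"
        then have l: "l < n" "l' < n" by auto
        then have "(M * V) $$ (l, l') = dot n (g (pick B l)) (W (pick B l'))"
          using card by (simp add: M_def V_def scalar_prod_def dot_def lessThan_atLeast0)
        also have "\<dots> = of_bool (pick B l = pick B l')"
          using W l card by (simp add: dual_rows_def pick_in_set_le)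
        also have "\<dots> = (1\<^sub>m n) $$ (l, l')"
          using bij l card by (auto simp: bij_betw_def inj_on_def)
        finally show "(M * V) $$ (l, l') = 1\<^sub>m n $$ (l, l')" .
      qed (auto simp: M_def V_def card)
      moreover have "V * M = 1\<^sub>m n"
      proof (rule eq_matI)
        fix c c' assume "c < dim_row (1\<^sub>m n :: real mat)" "c' < dim_col (1\<^sub>m n :: real mat)"
        then have c: "c < n" "c' < n" by auto
        then have "(V * M) $$ (c, c') = (\<Sum>l<n. W (pick B l) c * g (pick B l) c')"
          using card by (simp add: M_def V_def scalar_prod_def lessThan_atLeast0)
        also have "\<dots> = (\<Sum>b\<in>B. W b c * g b c')"
          using sum.reindex_bij_betw[OF bij, of "\<lambda>b. W b c * g b c'"] card by simp
        finally show "(V * M) $$ (c, c') = 1\<^sub>m n $$ (c, c')"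
          using W c by (simp add: dual_rows_def)
      qed (auto simp: M_def V_def card)
      ultimately show "invertible_mat M"
        unfolding invertible_mat_def inverts_mat_def by (auto simp: M_def V_def card intro!: exI[of _ V])
    qed
  qed
  then show ?thesis unfolding lp_basis_def n_def g_def by blast
qed

lemma eigenvalue_gram_iff:
  assumes "B \<subseteq> {..<dim_row G}"
  defines "n \<equiv> dim_col G" and "g \<equiv> entry_rows G" and "M \<equiv> row_submatrix G B"
  shows "eigenvalue (transpose_mat M * M) k \<longleftrightarrow>
    (\<exists>x. (\<exists>c<n. x c \<noteq> 0) \<and> (\<forall>c<n. (\<Sum>b\<in>B. dot n (g b) x * g b c) = k * x c))"
proof -
  have finB: "finite B" using assms(1) finite_subset by blast
  have M: "M = mat (card B) n (\<lambda>(k, c). g (pick B k) c)"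
    using row_submatrix_eq[OF assms(1)] by (simp add: n_def g_def M_def)
  define H where "H = transpose_mat M * M"
  have H: "H \<in> carrier_mat n n" unfolding H_def M by (intro carrier_matI) simp_all
  have entry: "H $$ (c, c') = (\<Sum>b\<in>B. g b c * g b c')" if "c < n" "c' < n" for c c'
  proof -
    have "H $$ (c, c') = (\<Sum>l<card B. g (pick B l) c * g (pick B l) c')"
      using that by (simp add: H_def M scalar_prod_def lessThan_atLeast0)
    then show ?thesis
      using sum.reindex_bij_betw[OF bij_betw_pick[OF finB], of "\<lambda>b. g b c * g b c'"] by simp
  qed
  have gram_apply: "(H *\<^sub>v v) $ c = (\<Sum>b\<in>B. dot n (g b) (\<lambda>c. v $ c) * g b c)"
    if "v \<in> carrier_vec n" "c < n" for v c
  proof -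
    have "(H *\<^sub>v v) $ c = (\<Sum>c'<n. H $$ (c, c') * v $ c')"
      using that H by (simp add: scalar_prod_def lessThan_atLeast0)
    also have "\<dots> = (\<Sum>c'<n. \<Sum>b\<in>B. g b c' * v $ c' * g b c)"
      using that by (simp add: entry sum_distrib_left sum_distrib_right mult_ac)
    also have "\<dots> = (\<Sum>b\<in>B. dot n (g b) (\<lambda>c. v $ c) * g b c)"
      unfolding dot_def sum_distrib_right by (rule sum.swap)
    finally show ?thesis .
  qed
  show ?thesis unfolding H_def[symmetric]
  proof
    assume "eigenvalue H k"
    then obtain v where v: "v \<in> carrier_vec n" "v \<noteq> 0\<^sub>v n" "H *\<^sub>v v = k \<cdot>\<^sub>v v"
      using H by (auto simp: eigenvalue_def eigenvector_def)
    then have "\<exists>c<n. v $ c \<noteq> 0" by (metis carrier_vecD dim_vec eq_vecI index_zero_vec(1) zero_vec_def)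
    moreover have "(\<Sum>b\<in>B. dot n (g b) (\<lambda>c. v $ c) * g b c) = k * v $ c" if "c < n" for c
      using gram_apply[OF v(1) that] v that by simp
    ultimately show "\<exists>x. (\<exists>c<n. x c \<noteq> 0) \<and> (\<forall>c<n. (\<Sum>b\<in>B. dot n (g b) x * g b c) = k * x c)"
      by blast
  next
    assume "\<exists>x. (\<exists>c<n. x c \<noteq> 0) \<and> (\<forall>c<n. (\<Sum>b\<in>B. dot n (g b) x * g b c) = k * x c)"
    then obtain x where x: "\<exists>c<n. x c \<noteq> 0" "\<And>c. c < n \<Longrightarrow> (\<Sum>b\<in>B. dot n (g b) x * g b c) = k * x c"
      by blast
    have "dot n u (\<lambda>c. vec n x $ c) = dot n u x" for u by (intro dot_cong) auto
    then have "H *\<^sub>v vec n x = k \<cdot>\<^sub>v vec n x"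
      using gram_apply[of "vec n x"] x(2) H by (intro eq_vecI) auto
    moreover have "vec n x \<noteq> 0\<^sub>v n" using x(1) by (metis index_vec index_zero_vec(1))
    ultimately show "eigenvalue H k" using H
      by (auto simp: eigenvalue_def eigenvector_def intro!: exI[of _ "vec n x"])
  qed
qed

text \<open>
The Rayleigh principle for \<open>M\<^sup>T M\<close> and for \<open>- M\<^sup>T M\<close> yields eigenvalues that bound \<open>|M x|\<^sup>2\<close> from above
and from below; their square roots lie between the extreme singular values.
\<close>

lemma singular_value_bounds:
  assumes "lp_basis G B" and n: "dim_col G \<ge> 1"
  defines "n \<equiv> dim_col G" and "g \<equiv> entry_rows G" and "M \<equiv> row_submatrix G B"
  shows "0 < sigma_min M"
    and "sigma_min M \<le> sigma_max M"
    and "\<And>x. (sigma_min M)\<^sup>2 * dot n x x \<le> (\<Sum>b\<in>B. (dot n (g b) x)\<^sup>2)"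
    and "\<And>x. (\<Sum>b\<in>B. (dot n (g b) x)\<^sup>2) \<le> (sigma_max M)\<^sup>2 * dot n x x"
proof -
  from assms(1) obtain W where BR: "B \<subseteq> {..<dim_row G}" and W: "dual_rows n g B W"
    by (auto simp: lp_basis_iff_dual_rows n_def g_def)
  have finB: "finite B" using W by (simp add: dual_rows_def)
  define ev where "ev = {k. eigenvalue (transpose_mat M * M) k}"
  have ev_iff: "k \<in> ev \<longleftrightarrow> (\<exists>x. (\<exists>c<n. x c \<noteq> 0) \<and> (\<forall>c<n. (\<Sum>b\<in>B. dot n (g b) x * g b c) = k * x c))" for k
    unfolding ev_def n_def g_def M_def using eigenvalue_gram_iff[OF BR] by simp
  have "transpose_mat M * M \<in> carrier_mat (dim_col M) (dim_col M)"
    by (intro carrier_matI) simp_all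
  from card_finite_spectrum(1)[OF this] have fin: "finite ev" by (simp add: ev_def spectrum_def)
  have gram: "dot n y (\<lambda>c. \<Sum>b\<in>B. dot n (g b) x * g b c) = (\<Sum>b\<in>B. dot n (g b) x * dot n (g b) y)" for x y
    unfolding dot_sum_right by (simp add: dot_commute[of n y])
  have ev_pos: "k > 0" if k: "k \<in> ev" for k
  proof -
    from k obtain x where x: "\<exists>c<n. x c \<noteq> 0" "\<forall>c<n. (\<Sum>b\<in>B. dot n (g b) x * g b c) = k * x c"
      unfolding ev_iff by blast
    have "k * dot n x x = dot n x (\<lambda>c. k * x c)" by (simp only: dot_scale_right)
    also have "\<dots> = dot n x (\<lambda>c. \<Sum>b\<in>B. dot n (g b) x * g b c)" using x(2) by (intro dot_cong) auto
    also have "\<dots> = (\<Sum>b\<in>B. (dot n (g b) x)\<^sup>2)" by (simp add: gram power2_eq_square)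
    finally have k_eq: "k * dot n x x = (\<Sum>b\<in>B. (dot n (g b) x)\<^sup>2)" .
    have "(\<Sum>b\<in>B. (dot n (g b) x)\<^sup>2) \<noteq> 0"
    proof
      assume "(\<Sum>b\<in>B. (dot n (g b) x)\<^sup>2) = 0"
      then have "\<forall>b\<in>B. dot n (g b) x = 0" using finB by (simp add: sum_nonneg_eq_0_iff)
      then have "x c = 0" if "c < n" for c using dual_rows_expand[OF W that, of x] by simp
      then show False using x(1) by auto
    qed
    then have "k * dot n x x > 0" unfolding k_eq by (simp add: sum_nonneg less_le)
    moreover have "dot n x x > 0" using x(1) dot_self_pos by blast
    ultimately show ?thesis by (simp add: zero_less_mult_iff)
  qed
  have extremal: "\<exists>k\<in>ev. \<forall>y. s * (\<Sum>b\<in>B. (dot n (g b) y)\<^sup>2) \<le> s * (k * dot n y y)"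
    if s: "s = 1 \<or> s = -1" for s :: real
  proof -
    define h where "h c c' = s * (\<Sum>b\<in>B. g b c * g b c')" for c c'
    have h: "dot n (h c) y = s * (\<Sum>b\<in>B. dot n (g b) y * g b c)" for c y
      unfolding dot_commute[of n "h c"] h_def dot_scale_right dot_sum_right
      by (simp add: dot_commute mult.commute)
    obtain x \<mu> where x: "dot n x x = 1" "\<And>c. c < n \<Longrightarrow> dot n (h c) x = \<mu> * x c"
      "\<And>y. dot n y (\<lambda>c. dot n (h c) y) \<le> \<mu> * dot n y y"
      using quadratic_form_max[of n h] n unfolding n_def by (auto simp: h_def mult.commute)
    have ss: "s * s = 1" using s by auto
    have "s * \<mu> \<in> ev" unfolding ev_iff
    proof (intro exI[of _ x] conjI allI impI)
      show "\<exists>c<n. x c \<noteq> 0" using x(1) by (auto simp: dot_def intro: ccontr)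
      fix c assume "c < n"
      then have "s * (s * (\<Sum>b\<in>B. dot n (g b) x * g b c)) = s * (\<mu> * x c)" using x(2)[of c] by (simp add: h)
      then show "(\<Sum>b\<in>B. dot n (g b) x * g b c) = s * \<mu> * x c" using ss by (simp add: mult.assoc[symmetric])
    qed
    moreover have "s * (\<Sum>b\<in>B. (dot n (g b) y)\<^sup>2) \<le> s * (s * \<mu> * dot n y y)" for y
      using x(3)[of y] ss unfolding h dot_scale_right gram
      by (simp add: power2_eq_square mult.assoc[symmetric])
    ultimately show ?thesis by blast
  qed
  have sv: "singular_values M = sqrt ` ev" by (simp add: singular_values_def ev_def)
  obtain k where k: "k \<in> ev" "\<And>y. (\<Sum>b\<in>B. (dot n (g b) y)\<^sup>2) \<le> k * dot n y y"
    using extremal[of 1] by auto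
  obtain l where l: "l \<in> ev" "\<And>y. l * dot n y y \<le> (\<Sum>b\<in>B. (dot n (g b) y)\<^sup>2)"
    using extremal[of "-1"] by auto
  have ne: "sqrt ` ev \<noteq> {}" "finite (sqrt ` ev)" using k fin by auto
  have kmax: "sqrt k \<le> sigma_max M" and lmin: "sigma_min M \<le> sqrt l"
    using k(1) l(1) ne by (auto simp: sigma_max_def sigma_min_def sv intro: Max_ge Min_le)
  show min_pos: "0 < sigma_min M" unfolding sigma_min_def sv using ne ev_pos by simp
  show "sigma_min M \<le> sigma_max M" unfolding sigma_min_def sigma_max_def sv
    by (rule Min.coboundedI[THEN order_trans, OF _ _ Max.coboundedI, of _ "sqrt k"]) (use ne k in auto)
  show "(sigma_min M)\<^sup>2 * dot n x x \<le> (\<Sum>b\<in>B. (dot n (g b) x)\<^sup>2)" for x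
  proof -
    have "(sigma_min M)\<^sup>2 \<le> (sqrt l)\<^sup>2" using lmin min_pos by (intro power_mono) auto
    then have "(sigma_min M)\<^sup>2 \<le> l" using ev_pos[OF l(1)] by simp
    then have "(sigma_min M)\<^sup>2 * dot n x x \<le> l * dot n x x"
      by (rule mult_right_mono) (simp add: dot_self)
    then show ?thesis using l(2)[of x] by linarith
  qed
  show "(\<Sum>b\<in>B. (dot n (g b) x)\<^sup>2) \<le> (sigma_max M)\<^sup>2 * dot n x x" for x
  proof -
    have "(sqrt k)\<^sup>2 \<le> (sigma_max M)\<^sup>2" using kmax ev_pos[OF k(1)] by (intro power_mono) auto
    then have "k \<le> (sigma_max M)\<^sup>2" using ev_pos[OF k(1)] by simp
    then have "k * dot n x x \<le> (sigma_max M)\<^sup>2 * dot n x x"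
      by (rule mult_right_mono) (simp add: dot_self)
    then show ?thesis using k(2)[of x] by linarith
  qed
qed

lemma finite_optimal_bases: "finite (optimal_bases G p)"
  by (rule finite_subset[of _ "Pow {..<dim_row G}"]) (auto simp: optimal_bases_def lp_basis_def)

lemma sigma_lower_upper_bounds:
  assumes B: "B \<in> optimal_bases G p" and n: "dim_col G \<ge> 1"
  defines "n \<equiv> dim_col G" and "g \<equiv> entry_rows G"
  shows "0 < sigma_lower G p"
    and "sigma_lower G p \<le> sigma_upper G p"
    and "\<And>x. (sigma_lower G p)\<^sup>2 * dot n x x \<le> (\<Sum>b\<in>B. (dot n (g b) x)\<^sup>2)"
    and "\<And>x. (\<Sum>b\<in>B. (dot n (g b) x)\<^sup>2) \<le> (sigma_upper G p)\<^sup>2 * dot n x x"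
proof -
  have basis: "lp_basis G C" if "C \<in> optimal_bases G p" for C using that by (simp add: optimal_bases_def)
  note sb = singular_value_bounds[OF basis n, folded n_def g_def]
  let ?M = "row_submatrix G B"
  show pos: "0 < sigma_lower G p"
    unfolding sigma_lower_def using B sb(1) finite_optimal_bases[of G p] by (subst Min_gr_iff) auto
  have lo: "sigma_lower G p \<le> sigma_min ?M"
    unfolding sigma_lower_def using B finite_optimal_bases[of G p] by (intro Min_le) auto
  have up: "sigma_max ?M \<le> sigma_upper G p"
    unfolding sigma_upper_def using B finite_optimal_bases[of G p] by (intro Max_ge) auto
  show "sigma_lower G p \<le> sigma_upper G p" using lo up sb(2)[OF B] by linarith
  show "(sigma_lower G p)\<^sup>2 * dot n x x \<le> (\<Sum>b\<in>B. (dot n (g b) x)\<^sup>2)" for x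
  proof -
    have "(sigma_lower G p)\<^sup>2 * dot n x x \<le> (sigma_min ?M)\<^sup>2 * dot n x x"
      using lo pos by (intro mult_right_mono power_mono) (auto simp: dot_self)
    then show ?thesis using sb(3)[OF B, of x] by linarith
  qed
  show "(\<Sum>b\<in>B. (dot n (g b) x)\<^sup>2) \<le> (sigma_upper G p)\<^sup>2 * dot n x x" for x
  proof -
    have "(sigma_max ?M)\<^sup>2 * dot n x x \<le> (sigma_upper G p)\<^sup>2 * dot n x x"
      using up sb(1,2)[OF B] by (intro mult_right_mono power_mono) (auto simp: dot_self)
    then show ?thesis using sb(4)[OF B, of x] by linarith
  qed
qed

lemma basic_solution_eq_vertex:
  assumes "B \<subseteq> {..<dim_row G}" and W: "dual_rows (dim_col G) (entry_rows G) B W"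
    and d: "d \<in> carrier_vec (dim_row G)"
  shows "basic_solution G B d = vec (dim_col G) (vertex B W (\<lambda>r. d $ r))"
proof -
  define n g where "n = dim_col G" and "g = entry_rows G"
  have W: "dual_rows n g B W" using W by (simp add: n_def g_def)
  have finB: "finite B" using W by (simp add: dual_rows_def)
  have "{i. i < dim_vec d \<and> i \<in> B} = B" using assms(1) d by auto
  then have sub: "subvector d B = vec (card B) (\<lambda>k. d $ pick B k)" by (simp add: subvector_def)
  have eq_iff: "row_submatrix G B *\<^sub>v z = subvector d B \<longleftrightarrow> (\<forall>b\<in>B. dot n (g b) (\<lambda>c. z $ c) = d $ b)"
    if z: "z \<in> carrier_vec n" for z
  proof -
    have "(row_submatrix G B *\<^sub>v z) $ k = dot n (g (pick B k)) (\<lambda>c. z $ c)" if "k < card B" for k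
      using that z row_submatrix_eq[OF assms(1)]
      by (simp add: scalar_prod_def dot_def lessThan_atLeast0 n_def g_def)
    then have "row_submatrix G B *\<^sub>v z = subvector d B
        \<longleftrightarrow> (\<forall>k<card B. dot n (g (pick B k)) (\<lambda>c. z $ c) = d $ pick B k)"
      using row_submatrix_eq[OF assms(1)] by (auto simp: sub vec_eq_iff)
    also have "\<dots> \<longleftrightarrow> (\<forall>b\<in>B. dot n (g b) (\<lambda>c. z $ c) = d $ b)"
      using bij_betw_pick[OF finB] unfolding bij_betw_def by (metis (no_types, lifting) image_iff lessThan_iff)
    finally show ?thesis .
  qed
  have vert: "dot n (g b) (\<lambda>c. vec n (vertex B W (\<lambda>r. d $ r)) $ c) = d $ b" if "b \<in> B" for b
  proof -
    have "dot n (g b) (\<lambda>c. vec n (vertex B W (\<lambda>r. d $ r)) $ c) = dot n (g b) (vertex B W (\<lambda>r. d $ r))"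
      by (intro dot_cong) auto
    then show ?thesis using row_vertex[OF W that] by simp
  qed
  show ?thesis unfolding basic_solution_def n_def[symmetric]
  proof (rule the_equality)
    show "vec n (vertex B W (\<lambda>r. d $ r)) \<in> carrier_vec n
        \<and> row_submatrix G B *\<^sub>v vec n (vertex B W (\<lambda>r. d $ r)) = subvector d B"
      using eq_iff vert by simp
  next
    fix z assume z: "z \<in> carrier_vec n \<and> row_submatrix G B *\<^sub>v z = subvector d B"
    then have "\<forall>b\<in>B. dot n (g b) (\<lambda>c. z $ c) = d $ b" using eq_iff by blast
    then have "z $ c = vertex B W (\<lambda>r. d $ r) c" if "c < n" for c
      using dual_rows_expand[OF W that, of "\<lambda>c. z $ c"] by (simp add: vertex_def)
    then show "z = vec n (vertex B W (\<lambda>r. d $ r))" using z by (intro eq_vecI) auto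
  qed
qed

lemma lp_feasible_iff:
  assumes "d \<in> carrier_vec (dim_row G)"
  shows "lp_feasible G d z \<longleftrightarrow> z \<in> carrier_vec (dim_col G) \<and>
     feasible (dim_col G) (entry_rows G) {..<dim_row G} (\<lambda>r. d $ r) (\<lambda>c. z $ c)"
proof -
  have "(G *\<^sub>v z) $ r = dot (dim_col G) (entry_rows G r) (\<lambda>c. z $ c)"
    if "r < dim_row G" "z \<in> carrier_vec (dim_col G)" for r
    using that by (simp add: scalar_prod_def dot_def entry_rows_def lessThan_atLeast0)
  then show ?thesis using assms by (auto simp: lp_feasible_def less_eq_vec_def feasible_def)
qed

section \<open>Decay of solutions of a banded linear program\<close>

text \<open>
A cost without dual degeneracy whose dual feasible bases are all dual feasible for the given cost.
One inverse is fixed for each basis in order to have finitely many vectors to perturb away from;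
uniqueness of the inverse transfers the conclusion to all of them.
\<close>

lemma generic_cost:
  assumes "finite R"
  obtains p' where
    "\<And>B W b. dual_rows n g B W \<Longrightarrow> B \<subseteq> R \<Longrightarrow> b \<in> B \<Longrightarrow> dot n p' (W b) \<noteq> 0"
    "\<And>B W b. dual_rows n g B W \<Longrightarrow> B \<subseteq> R \<Longrightarrow> b \<in> B \<Longrightarrow> dot n p' (W b) > 0 \<Longrightarrow> dot n p (W b) \<ge> 0"
proof -
  define \<B> where "\<B> = {B. B \<subseteq> R \<and> (\<exists>W. dual_rows n g B W)}"
  have "\<exists>V. \<forall>B\<in>\<B>. dual_rows n g B (V B)" by (rule bchoice) (auto simp: \<B>_def)
  then obtain V where V: "\<And>B. B \<in> \<B> \<Longrightarrow> dual_rows n g B (V B)" by blast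
  have "finite \<B>" by (rule finite_subset[of _ "Pow R"]) (auto simp: \<B>_def assms)
  moreover have "finite B" if "B \<in> \<B>" for B using V[OF that] by (simp add: dual_rows_def)
  ultimately have "finite (\<Union>B\<in>\<B>. V B ` B)" by simp
  moreover have "\<exists>c<n. w c \<noteq> 0" if "w \<in> (\<Union>B\<in>\<B>. V B ` B)" for w
    using that V dual_rows_nonzero by fastforce
  ultimately obtain p' where p': "\<And>w. w \<in> (\<Union>B\<in>\<B>. V B ` B) \<Longrightarrow> dot n p' w \<noteq> 0"
    "\<And>w. w \<in> (\<Union>B\<in>\<B>. V B ` B) \<Longrightarrow> dot n p w < 0 \<Longrightarrow> dot n p' w < 0"
    using generic_perturbation[of "\<Union>B\<in>\<B>. V B ` B" n p] by blast
  have V_eq: "dot n u (W b) = dot n u (V B b)" "V B b \<in> (\<Union>B\<in>\<B>. V B ` B)"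
    if "dual_rows n g B W" "B \<subseteq> R" "b \<in> B" for B W b u
  proof -
    have B: "B \<in> \<B>" using that by (auto simp: \<B>_def)
    show "dot n u (W b) = dot n u (V B b)"
      using dual_rows_unique[OF V[OF B] that(1,3)] by (intro dot_cong) auto
    show "V B b \<in> (\<Union>B\<in>\<B>. V B ` B)" using B that(3) by blast
  qed
  show ?thesis
  proof (rule that[of p'])
    fix B W b assume B: "dual_rows n g B W" "B \<subseteq> R" "b \<in> B"
    show "dot n p' (W b) \<noteq> 0" using p'(1) V_eq[OF B] by metis
    show "dot n p (W b) \<ge> 0" if "dot n p' (W b) > 0"
      using p'(2)[OF V_eq(2)[OF B]] that unfolding V_eq(1)[OF B] by linarith
  qed
qed

text \<open>
The statement for an arbitrary linear program whose constraint matrix is banded: a row in row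
block \<open>k\<close> touches only the column blocks \<open>k\<close> and \<open>k - 1\<close>. The assumption \<open>start\<close> provides a dual
feasible basis for every cost.

The perturbed cost \<open>p'\<close> selects one solution \<open>\<phi> s\<close> of the original program for each point of the
segment from \<open>d\<close> to \<open>d'\<close>. On the set of parameters where a fixed basis is feasible, \<open>\<phi>\<close> is
affine and \<open>block_decay_superposition\<close> bounds its slope; since the selection is unique,
the pieces fit together at common points.
\<close>

theorem banded_lp_decay:
  fixes G :: "real mat" and p d d' :: "real vec" and cb rb :: "nat \<Rightarrow> nat"
  defines "n \<equiv> dim_col G" and "g \<equiv> entry_rows G" and "R \<equiv> {..<dim_row G}"
    and "\<alpha> \<equiv> sigma_lower G p" and "\<beta> \<equiv> sigma_upper G p"
  assumes n: "dim_col G \<ge> 1" and p: "p \<in> carrier_vec (dim_col G)"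
    and start: "\<And>q. \<exists>B W. dual_rows n g B W \<and> B \<subseteq> R \<and> (\<forall>b\<in>B. dot n q (W b) \<ge> 0)"
    and band: "\<And>r c. r \<in> R \<Longrightarrow> c < n \<Longrightarrow> g r c \<noteq> 0 \<Longrightarrow> cb c = rb r \<or> Suc (cb c) = rb r"
    and J: "finite J" "rb ` R \<subseteq> J"
    and d: "d \<in> lp_feasible_data G" and d': "d' \<in> lp_feasible_data G"
  shows "\<exists>z z'. lp_solution G p d z \<and> lp_solution G p d' z' \<and>
    (\<forall>i. L2_set (\<lambda>c. z $ c - z' $ c) {c. c < n \<and> cb c = i}
      \<le> (\<Sum>j\<in>J. \<beta> / \<alpha>\<^sup>2 * ((\<beta>\<^sup>2 - \<alpha>\<^sup>2) / (\<beta>\<^sup>2 + \<alpha>\<^sup>2)) ^ nat (\<bar>int i - int j\<bar> - 1) *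
            L2_set (\<lambda>r. d $ r - d' $ r) {r \<in> R. rb r = j}))"
proof -
  define P where "P = (\<lambda>c. p $ c)"
  have dc: "d \<in> carrier_vec (dim_row G)" "d' \<in> carrier_vec (dim_row G)"
    using d d' by (auto simp: lp_feasible_data_def)
  have "finite R" by (simp add: R_def)
  obtain p' where generic: "\<And>B W b. dual_rows n g B W \<Longrightarrow> B \<subseteq> R \<Longrightarrow> b \<in> B \<Longrightarrow> dot n p' (W b) \<noteq> 0"
    and dual: "\<And>B W b. dual_rows n g B W \<Longrightarrow> B \<subseteq> R \<Longrightarrow> b \<in> B \<Longrightarrow> dot n p' (W b) > 0 \<Longrightarrow> dot n P (W b) \<ge> 0"
    using generic_cost[OF \<open>finite R\<close>, of n g P] by blast

  define \<B> where "\<B> = {B. B \<subseteq> R \<and> (\<exists>W. dual_rows n g B W \<and> (\<forall>b\<in>B. dot n p' (W b) > 0))}"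
  have "\<exists>V. \<forall>B\<in>\<B>. dual_rows n g B (V B) \<and> (\<forall>b\<in>B. dot n p' (V B b) > 0)"
    by (rule bchoice) (auto simp: \<B>_def)
  then obtain V where V: "\<And>B. B \<in> \<B> \<Longrightarrow> dual_rows n g B (V B)"
    and Vpos: "\<And>B. B \<in> \<B> \<Longrightarrow> \<forall>b\<in>B. dot n p' (V B b) > 0" by blast
  have BR: "B \<subseteq> R" if "B \<in> \<B>" for B using that by (simp add: \<B>_def)
  have "finite \<B>" by (rule finite_subset[of _ "Pow R"]) (auto simp: \<B>_def \<open>finite R\<close>)

  \<comment> \<open>The segment of data, the vertex of each basis along it, and the parameters where it is feasible.\<close>
  define e where "e s r = d $ r + s * (d' $ r - d $ r)" for s r
  define \<zeta> where "\<zeta> B s = vertex B (V B) (e s)" for B s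
  define T where "T B = {s. feasible n g R (e s) (\<zeta> B s)}" for B

  have \<zeta>_optimal: "lp_solution G p x (vec n (\<zeta> B s))"
    if B: "B \<in> \<B>" and s: "s \<in> T B" and x: "x = vec (dim_row G) (e s)" for B s x
  proof -
    have xc: "x \<in> carrier_vec (dim_row G)" by (simp add: x)
    have feas_iff: "lp_feasible G x z \<longleftrightarrow> z \<in> carrier_vec n \<and> feasible n g R (e s) (\<lambda>c. z $ c)" for z
      unfolding lp_feasible_iff[OF xc] by (auto simp: x n_def g_def R_def feasible_def)
    have dot_eq: "dot n u (\<lambda>c. vec n (\<zeta> B s) $ c) = dot n u (\<zeta> B s)" for u by (intro dot_cong) auto
    have pz: "p \<bullet> z = dot n P (\<lambda>c. z $ c)" if "z \<in> carrier_vec n" for z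
      using that by (simp add: scalar_prod_def dot_def P_def lessThan_atLeast0)
    show ?thesis unfolding lp_solution_def
    proof (intro conjI allI impI)
      show "lp_feasible G x (vec n (\<zeta> B s))"
        unfolding feas_iff using s by (simp add: T_def feasible_def dot_eq)
      fix y assume y: "lp_feasible G x y"
      have "dot n P (\<zeta> B s) \<le> dot n P (\<lambda>c. y $ c)" unfolding \<zeta>_def
        using y feas_iff dual[OF V[OF B] BR[OF B]] Vpos[OF B]
        by (intro vertex_optimal[OF V[OF B] BR[OF B]]) auto
      then show "p \<bullet> vec n (\<zeta> B s) \<le> p \<bullet> y" using y feas_iff by (simp add: pz dot_eq)
    qed
  qed

  have optimal_basis: "B \<in> optimal_bases G p" if B: "B \<in> \<B>" and s: "s \<in> T B" for B s
  proof -
    let ?x = "vec (dim_row G) (e s)"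
    have "lp_basis G B" using V[OF B] BR[OF B] by (auto simp: lp_basis_iff_dual_rows n_def g_def R_def)
    moreover have sol: "lp_solution G p ?x (vec n (\<zeta> B s))" by (rule \<zeta>_optimal[OF B s refl])
    moreover have "basic_solution G B ?x = vec n (\<zeta> B s)"
    proof -
      have "b < dim_row G" if "b \<in> B" for b using BR[OF B] that by (auto simp: R_def)
      then have "vertex B (V B) (\<lambda>r. ?x $ r) = \<zeta> B s"
        by (auto simp: vertex_def \<zeta>_def fun_eq_iff intro!: sum.cong)
      then show ?thesis
        using basic_solution_eq_vertex[of B G "V B" ?x] V[OF B] BR[OF B] by (simp add: n_def g_def R_def)
    qed
    moreover have "?x \<in> lp_feasible_data G"
      using sol by (auto simp: lp_feasible_data_def lp_solution_def)
    ultimately show ?thesis unfolding optimal_bases_def by (auto intro!: bexI[of _ ?x])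
  qed

  \<comment> \<open>Two feasible vertices are both optimal for the nondegenerate cost, hence equal.\<close>
  have unique: "\<zeta> B s c = \<zeta> C s c" if "B \<in> \<B>" "C \<in> \<B>" "s \<in> T B" "s \<in> T C" "c < n" for B C s c
  proof -
    have "dot n p' (\<zeta> B s) \<le> dot n p' (\<zeta> C s)"
      unfolding \<zeta>_def[of B] using that Vpos[OF that(1)]
      by (intro vertex_optimal[OF V BR]) (auto simp: T_def intro: less_imp_le)
    then show ?thesis
      using vertex_unique_optimum[OF V[OF that(2)] BR[OF that(2)] Vpos[OF that(2)], of "e s" "\<zeta> B s" c] that
      by (simp add: T_def \<zeta>_def)
  qed

  have cover: "{0..1} \<subseteq> \<Union>(T ` \<B>)"
  proof
    fix s :: real assume s: "s \<in> {0..1}"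
    obtain y y' where y: "feasible n g R (\<lambda>r. d $ r) y" "feasible n g R (\<lambda>r. d' $ r) y'"
      using d d' lp_feasible_iff[OF dc(1)] lp_feasible_iff[OF dc(2)]
      by (auto simp: lp_feasible_data_def n_def g_def R_def)
    have "feasible n g R (e s) (\<lambda>c. (1 - s) * y c + s * y' c)" unfolding feasible_def
    proof
      fix r assume "r \<in> R"
      then have "(1 - s) * d $ r \<le> (1 - s) * dot n (g r) y" "s * d' $ r \<le> s * dot n (g r) y'"
        using y s by (auto simp: feasible_def intro!: mult_left_mono)
      then show "e s r \<le> dot n (g r) (\<lambda>c. (1 - s) * y c + s * y' c)"
        unfolding dot_add_right dot_scale_right e_def by (simp add: algebra_simps)
    qed
    note feas = this
    obtain B0 W0 where start_basis: "dual_rows n g B0 W0" "B0 \<subseteq> R" "\<forall>b\<in>B0. dot n p' (W0 b) \<ge> 0"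
      using start[of p'] by blast
    obtain B W where B: "dual_rows n g B W" "B \<subseteq> R" "\<forall>b\<in>B. dot n p' (W b) > 0"
      "feasible n g R (e s) (vertex B W (e s))"
      by (rule dual_simplex[of R n g p' B0 W0 "e s", OF \<open>finite R\<close> _ start_basis feas])
        (use generic in blast)+
    then have "B \<in> \<B>" by (auto simp: \<B>_def)
    have "dot n (g r) (\<zeta> B s) = dot n (g r) (vertex B W (e s))" for r
      unfolding \<zeta>_def dot_vertex using dual_rows_unique[OF V[OF \<open>B \<in> \<B>\<close>] B(1)]
      by (intro sum.cong arg_cong2[of _ _ _ _ "(*)"] dot_cong refl) auto
    then have "s \<in> T B" using B(4) by (simp add: T_def feasible_def)
    then show "s \<in> \<Union>(T ` \<B>)" using \<open>B \<in> \<B>\<close> by blast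
  qed

  have closed: "closed (T B)" for B
  proof -
    have "T B = (\<Inter>r\<in>R. {s. e s r \<le> dot n (g r) (\<zeta> B s)})" by (auto simp: T_def feasible_def)
    moreover have "closed {s. e s r \<le> dot n (g r) (\<zeta> B s)}" for r
      unfolding \<zeta>_def dot_vertex e_def by (intro closed_Collect_le continuous_intros)
    ultimately show ?thesis by (metis (no_types, lifting) closed_INT)
  qed

  have "\<exists>S. \<forall>s\<in>{0..1}. S s \<in> \<B> \<and> s \<in> T (S s)"
    by (rule bchoice) (use cover in blast)
  then obtain S where S: "\<And>s. s \<in> {0..1} \<Longrightarrow> S s \<in> \<B> \<and> s \<in> T (S s)" by blast
  define \<phi> where "\<phi> s = \<zeta> (S s) s" for s
  have \<phi>_eq: "\<phi> s c = \<zeta> B s c" if "s \<in> {0..1}" "B \<in> \<B>" "s \<in> T B" "c < n" for s B c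
    unfolding \<phi>_def using unique S[OF that(1)] that by blast

  define \<rho> where "\<rho> = (\<beta>\<^sup>2 - \<alpha>\<^sup>2) / (\<beta>\<^sup>2 + \<alpha>\<^sup>2)"
  define bound where "bound i = (\<Sum>j\<in>J. \<beta> / \<alpha>\<^sup>2 * \<rho> ^ nat (\<bar>int i - int j\<bar> - 1) *
            L2_set (\<lambda>r. d $ r - d' $ r) {r \<in> R. rb r = j})" for i
  have piece: "L2_set (\<lambda>c. \<phi> s c - \<phi> t c) {c. c < n \<and> cb c = i} \<le> bound i * (t - s)"
    if B: "B \<in> \<B>" and st: "s \<in> T B" "t \<in> T B" "s \<in> {0..1}" "t \<in> {0..1}" "s \<le> t" for B s t i
  proof -
    define \<delta> where "\<delta> = (\<lambda>r. d $ r - d' $ r)"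
    note sg = sigma_lower_upper_bounds[OF optimal_basis[OF B st(1)] n,
        folded n_def g_def \<alpha>_def \<beta>_def]
    have "\<beta>\<^sup>2 \<ge> \<alpha>\<^sup>2" using sg(1,2) by (simp add: power_mono)
    then have \<rho>: "\<rho> \<ge> 0" by (simp add: \<rho>_def)
    have "\<phi> s c - \<phi> t c = (t - s) * vertex B (V B) \<delta> c" if "c < n" for c
      using \<phi>_eq[OF st(3) B st(1) that] \<phi>_eq[OF st(4) B st(2) that]
      by (simp add: \<zeta>_def vertex_def e_def \<delta>_def sum_distrib_left flip: sum_subtractf)
        (intro sum.cong refl, simp add: algebra_simps)
    then have eq: "L2_set (\<lambda>c. \<phi> s c - \<phi> t c) {c. c < n \<and> cb c = i}
        = (t - s) * L2_set (vertex B (V B) \<delta>) {c. c < n \<and> cb c = i}"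
      using st(5) by (simp add: L2_set_right_distrib cong: L2_set_cong_simp)
    have "L2_set (vertex B (V B) \<delta>) {c. c < n \<and> cb c = i}
        \<le> (\<Sum>j\<in>J. \<rho> ^ nat (\<bar>int i - int j\<bar> - 1) * (L2_set \<delta> {b\<in>B. rb b = j} / \<alpha>))"
      unfolding \<rho>_def
    proof (intro block_decay_superposition[OF V[OF B] sg])
      show "rb ` B \<subseteq> J" using BR[OF B] J(2) by blast
    qed (use BR[OF B] band J(1) in auto)
    also have "\<dots> \<le> bound i" unfolding bound_def
    proof (rule sum_mono)
      fix j
      have "L2_set \<delta> {b\<in>B. rb b = j} \<le> L2_set \<delta> {r\<in>R. rb r = j}"
        unfolding L2_set_def using BR[OF B] \<open>finite R\<close>
        by (intro real_sqrt_le_mono sum_mono2) auto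
      then have "L2_set \<delta> {b\<in>B. rb b = j} / \<alpha> \<le> 1 / \<alpha> * L2_set \<delta> {r\<in>R. rb r = j}"
        using sg(1) by (simp add: divide_right_mono)
      also have "\<dots> \<le> \<beta> / \<alpha>\<^sup>2 * L2_set \<delta> {r\<in>R. rb r = j}"
        using sg(1,2) by (intro mult_right_mono) (auto simp: field_simps power2_eq_square)
      finally have "\<rho> ^ nat (\<bar>int i - int j\<bar> - 1) * (L2_set \<delta> {b\<in>B. rb b = j} / \<alpha>)
          \<le> \<rho> ^ nat (\<bar>int i - int j\<bar> - 1) * (\<beta> / \<alpha>\<^sup>2 * L2_set \<delta> {r\<in>R. rb r = j})"
        using \<rho> by (intro mult_left_mono) auto
      then show "\<rho> ^ nat (\<bar>int i - int j\<bar> - 1) * (L2_set \<delta> {b\<in>B. rb b = j} / \<alpha>)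
          \<le> \<beta> / \<alpha>\<^sup>2 * \<rho> ^ nat (\<bar>int i - int j\<bar> - 1) * L2_set (\<lambda>r. d $ r - d' $ r) {r \<in> R. rb r = j}"
        by (simp add: \<delta>_def mult_ac)
    qed
    finally have "L2_set (vertex B (V B) \<delta>) {c. c < n \<and> cb c = i} \<le> bound i" .
    then show ?thesis
      unfolding eq mult.commute[of "bound i"] using st(5) by (intro mult_left_mono) auto
  qed

  have total: "L2_set (\<lambda>c. \<phi> 0 c - \<phi> 1 c) {c. c < n \<and> cb c = i} \<le> bound i" for i
  proof -
    let ?D = "\<lambda>s t. L2_set (\<lambda>c. \<phi> s c - \<phi> t c) {c. c < n \<and> cb c = i}"
    have "?D 0 1 \<le> bound i * (1 - 0)"
    proof (rule lipschitz_along_closed_cover[of "(\<lambda>B. T B \<inter> {0..1}) ` \<B>" _ _ ?D])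
      show "{0..1} \<subseteq> \<Union>((\<lambda>B. T B \<inter> {0..1}) ` \<B>)" using cover by auto
      show "?D r t \<le> ?D r s + ?D s t" for r s t
        using L2_set_triangle_ineq[of "\<lambda>c. \<phi> r c - \<phi> s c" "\<lambda>c. \<phi> s c - \<phi> t c" "{c. c < n \<and> cb c = i}"]
        by simp
    qed (use \<open>finite \<B>\<close> closed piece in auto)
    then show ?thesis by simp
  qed

  show ?thesis
  proof (intro exI conjI allI)
    have "d = vec (dim_row G) (e 0)" "d' = vec (dim_row G) (e 1)"
      using dc by (auto simp: e_def)
    then show "lp_solution G p d (vec n (\<phi> 0))" "lp_solution G p d' (vec n (\<phi> 1))"
      unfolding \<phi>_def using S[of 0] S[of 1] by (auto intro!: \<zeta>_optimal)
    fix i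
    have "L2_set (\<lambda>c. vec n (\<phi> 0) $ c - vec n (\<phi> 1) $ c) {c. c < n \<and> cb c = i}
        = L2_set (\<lambda>c. \<phi> 0 c - \<phi> 1 c) {c. c < n \<and> cb c = i}"
      by (intro L2_set_cong) auto
    then show "L2_set (\<lambda>c. vec n (\<phi> 0) $ c - vec n (\<phi> 1) $ c) {c. c < n \<and> cb c = i}
        \<le> (\<Sum>j\<in>J. \<beta> / \<alpha>\<^sup>2 * ((\<beta>\<^sup>2 - \<alpha>\<^sup>2) / (\<beta>\<^sup>2 + \<alpha>\<^sup>2)) ^ nat (\<bar>int i - int j\<bar> - 1) *
            L2_set (\<lambda>r. d $ r - d' $ r) {r \<in> R. rb r = j})"
      using total[of i] by (simp add: bound_def \<rho>_def)
  qed
qed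

section \<open>The constraint matrix of the control problem\<close>

text \<open>
Rows that are unit vectors up to sign form an orthogonal matrix and are therefore their own dual
system.
\<close>

lemma dual_rows_signed_unit_rows:
  assumes unit: "\<And>c c'. c < n \<Longrightarrow> c' < n \<Longrightarrow> g (\<tau> c) c' = s c * of_bool (c = c')"
    and s: "\<And>c. c < n \<Longrightarrow> s c * s c = (1 :: real)"
  shows "dual_rows n g (\<tau> ` {..<n}) g"
proof -
  have inj: "inj_on \<tau> {..<n}"
  proof (rule inj_onI)
    fix c c' assume c: "c \<in> {..<n}" "c' \<in> {..<n}" "\<tau> c = \<tau> c'"
    have "s c = s c' * of_bool (c' = c)" using unit[of c c] unit[of c' c] c by simp
    then show "c = c'" using s[of c] c(1) by (cases "c' = c") auto
  qed
  have "dot n (g (\<tau> c)) (g (\<tau> c')) = of_bool (\<tau> c = \<tau> c')" if c: "c < n" "c' < n" for c c'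
  proof -
    have "dot n (g (\<tau> c)) (g (\<tau> c')) = (\<Sum>k<n. (s c * s c' * of_bool (c' = k)) * of_bool (c = k))"
      unfolding dot_def using c by (intro sum.cong) (simp_all add: unit)
    also have "\<dots> = s c * s c' * of_bool (c' = c)" using c by (intro sum_of_bool_eq) auto
    also have "\<dots> = of_bool (\<tau> c = \<tau> c')"
      using inj c s[of c] by (auto simp: inj_on_eq_iff)
    finally show ?thesis .
  qed
  moreover have "(\<Sum>b\<in>\<tau> ` {..<n}. g b c * g b c') = of_bool (c = c')" if c: "c < n" "c' < n" for c c'
  proof -
    have "(\<Sum>b\<in>\<tau> ` {..<n}. g b c * g b c') = (\<Sum>k<n. (s k * s k * of_bool (k = c')) * of_bool (k = c))"
      using c by (simp add: sum.reindex[OF inj] unit mult_ac)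
    also have "\<dots> = s c * s c * of_bool (c = c')" using c by (intro sum_of_bool_eq) auto
    finally show ?thesis using s c by simp
  qed
  ultimately show ?thesis unfolding dual_rows_def by auto
qed

lemma append_rows_index:
  assumes "i < dim_row X + dim_row Y" "j < dim_col X"
  shows "(X @\<^sub>r Y) $$ (i, j) = (if i < dim_row X then X $$ (i, j) else Y $$ (i - dim_row X, j))"
  using assms by (simp add: append_rows_def)

lemma append_rows_dim:
  "dim_row (X @\<^sub>r Y) = dim_row X + dim_row Y" "dim_col (X @\<^sub>r Y) = dim_col X"
  by (simp_all add: append_rows_def)

lemma append_cols_index:
  assumes "i < dim_row X" "j < dim_col X + dim_col Y"
  shows "append_cols X Y $$ (i, j) = (if j < dim_col X then X $$ (i, j) else Y $$ (i, j - dim_col X))"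
  using assms by (simp add: append_cols_def)

lemma append_cols_dim:
  "dim_row (append_cols X Y) = dim_row X" "dim_col (append_cols X Y) = dim_col X + dim_col Y"
  by (simp_all add: append_cols_def)

lemma mpc_matrix_dim:
  "dim_row (mpc_matrix N nx nu nw A B E F) = (4 * nx + 2 * nu + 2 * nw) * N"
  "dim_col (mpc_matrix N nx nu nw A B E F) = (nx + nu) * N"
  by (simp_all add: mpc_matrix_def Let_def)

lemma mpc_matrix_entry:
  assumes "r < (4 * nx + 2 * nu + 2 * nw) * N" "c < (nx + nu) * N"
  shows "mpc_matrix N nx nu nw A B E F $$ (r, c) =
    mpc_block nx nu nw A B E F (r div (4 * nx + 2 * nu + 2 * nw) + 1) (c div (nx + nu) + 1) $$
      (r mod (4 * nx + 2 * nu + 2 * nw), c mod (nx + nu))"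
  using assms by (simp add: mpc_matrix_def Let_def)

lemma mpc_matrix_band:
  assumes "r < (4 * nx + 2 * nu + 2 * nw) * N" "c < (nx + nu) * N"
    and "mpc_matrix N nx nu nw A B E F $$ (r, c) \<noteq> 0"
  shows "c div (nx + nu) = r div (4 * nx + 2 * nu + 2 * nw) \<or>
    Suc (c div (nx + nu)) = r div (4 * nx + 2 * nu + 2 * nw)"
proof (rule ccontr)
  assume far: "\<not> ?thesis"
  have "0 < (4 * nx + 2 * nu + 2 * nw) * N" using assms(1) by linarith
  then have "0 < 4 * nx + 2 * nu + 2 * nw" by (metis mult_0 neq0_conv)
  then have "r mod (4 * nx + 2 * nu + 2 * nw) < 4 * nx + 2 * nu + 2 * nw" by (rule mod_less_divisor)
  moreover have "0 < (nx + nu) * N" using assms(2) by linarith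
  then have "0 < nx + nu" by (metis mult_0 neq0_conv)
  then have "c mod (nx + nu) < nx + nu" by (rule mod_less_divisor)
  ultimately show False
    using assms(3) far unfolding mpc_matrix_entry[OF assms(1,2)] mpc_block_def by auto
qed

text \<open>
The position, within a stage, of the row that bounds component \<open>l\<close> of \<open>z\<^sub>i = (x\<^sub>i, u\<^sub>i)\<close> from below or
from above. For \<open>x\<^sub>i\<close> the rows of the fifth and sixth block are taken and not those of the first and
second, which also involve the preceding stage.
\<close>

definition bound_row :: "nat \<Rightarrow> nat \<Rightarrow> nat \<Rightarrow> bool \<Rightarrow> nat \<Rightarrow> nat" where
  "bound_row nx nu nw upper l =
     (if l < nx then 2 * nx + 2 * nw + l + (if upper then nx else 0)
      else 4 * nx + 2 * nw + (l - nx) + (if upper then nu else 0))"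

lemma bound_row_bounds:
  assumes "l < nx + nu"
  shows "2 * nx \<le> bound_row nx nu nw up l" "bound_row nx nu nw up l < 4 * nx + 2 * nu + 2 * nw"
  using assms by (auto simp: bound_row_def)

lemma mpc_diag_block_bound_row:
  assumes "l < nx + nu" "l' < nx + nu" and E: "E i \<in> carrier_mat nw nx" and F: "F i \<in> carrier_mat nw nu"
  shows "mpc_diag_block nx nu E F i $$ (bound_row nx nu nw up l, l')
       = (if up then - 1 else 1) * of_bool (l = l')"
proof -
  have dims: "dim_row (E i) = nw" "dim_col (E i) = nx" "dim_row (F i) = nw" "dim_col (F i) = nu"
    using E F by auto
  show ?thesis
    using assms(1,2) unfolding mpc_diag_block_def bound_row_def
    by (cases up; cases "l < nx")
      (auto simp: append_rows_index append_rows_dim append_cols_index append_cols_dim dims)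
qed

lemma mpc_sub_block_lower_rows:
  assumes "2 * nx \<le> k" "k < 4 * nx + 2 * nu + 2 * nw" "l < nx + nu"
    and "A (i - 1) \<in> carrier_mat nx nx" "B (i - 1) \<in> carrier_mat nx nu"
  shows "mpc_sub_block nx nu nw A B i $$ (k, l) = 0"
  using assms unfolding mpc_sub_block_def
  by (auto simp: append_rows_index append_rows_dim append_cols_index append_cols_dim)

lemma mpc_matrix_bound_row:
  fixes N nx nu nw :: nat and up :: bool
  defines "n \<equiv> nx + nu" and "m \<equiv> 4 * nx + 2 * nu + 2 * nw"
  assumes c: "c < n * N" "c' < n * N"
    and A: "\<And>i. 1 \<le> i \<Longrightarrow> i \<le> N - 1 \<Longrightarrow> A i \<in> carrier_mat nx nx"
    and B: "\<And>i. 1 \<le> i \<Longrightarrow> i \<le> N - 1 \<Longrightarrow> B i \<in> carrier_mat nx nu"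
    and E: "\<And>i. 1 \<le> i \<Longrightarrow> i \<le> N \<Longrightarrow> E i \<in> carrier_mat nw nx"
    and F: "\<And>i. 1 \<le> i \<Longrightarrow> i \<le> N \<Longrightarrow> F i \<in> carrier_mat nw nu"
  defines "r \<equiv> (c div n) * m + bound_row nx nu nw up (c mod n)"
  shows "r < m * N"
    and "mpc_matrix N nx nu nw A B E F $$ (r, c') = (if up then - 1 else 1) * of_bool (c = c')"
proof -
  have n: "n > 0" using c(1) by (metis mult_0 not_less0 neq0_conv)
  have blk: "c div n < N" "c' div n < N" using c n by (simp_all add: less_mult_imp_div_less mult.commute)
  have mods: "c mod n < n" "c' mod n < n" using n by simp_all
  note bb = bound_row_bounds[OF mods(1)[unfolded n_def], where up = up and nw = nw, folded n_def, folded m_def]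
  have rd: "r div m = c div n" "r mod m = bound_row nx nu nw up (c mod n)"
    using bb(2) by (simp_all add: r_def)
  have "r < (c div n) * m + m" using bb(2) by (simp add: r_def)
  also have "\<dots> = Suc (c div n) * m" by simp
  also have "\<dots> \<le> N * m" using blk(1) by (intro mult_le_mono1) simp
  finally show rN: "r < m * N" by (simp add: mult.commute)
  have entry: "mpc_matrix N nx nu nw A B E F $$ (r, c')
      = mpc_block nx nu nw A B E F (c div n + 1) (c' div n + 1) $$ (bound_row nx nu nw up (c mod n), c' mod n)"
    using mpc_matrix_entry[of r nx nu nw N c' A B E F] rN c(2) rd by (simp add: n_def m_def)
  have eq_iff: "c = c' \<longleftrightarrow> c div n = c' div n \<and> c mod n = c' mod n"
    by (metis div_mult_mod_eq)
  consider "c div n = c' div n" | "c div n = c' div n + 1" | "c div n \<noteq> c' div n" "c div n \<noteq> c' div n + 1"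
    by blast
  then show "mpc_matrix N nx nu nw A B E F $$ (r, c') = (if up then - 1 else 1) * of_bool (c = c')"
  proof cases
    case 1
    have "mpc_diag_block nx nu E F (c div n + 1) $$ (bound_row nx nu nw up (c mod n), c' mod n)
        = (if up then - 1 else 1) * of_bool (c mod n = c' mod n)"
      using mods blk(1) by (intro mpc_diag_block_bound_row E F) (auto simp: n_def)
    then show ?thesis using 1 eq_iff unfolding entry mpc_block_def by simp
  next
    case 2
    have "mpc_sub_block nx nu nw A B (c div n + 1) $$ (bound_row nx nu nw up (c mod n), c' mod n) = 0"
      using mods bb blk(1) 2 by (intro mpc_sub_block_lower_rows A B) (auto simp: n_def m_def)
    then show ?thesis using 2 eq_iff unfolding entry mpc_block_def by simp
  next
    case 3
    then show ?thesis using eq_iff bb mods unfolding entry mpc_block_def n_def m_def by auto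
  qed
qed

section \<open>Blocks of vectors\<close>

lemma euclid_norm_eq_L2_set: "euclid_norm v = L2_set (\<lambda>l. v $ l) {..<dim_vec v}"
  by (simp add: euclid_norm_def L2_set_def scalar_prod_def power2_eq_square lessThan_atLeast0)

lemma euclid_norm_block_diff:
  assumes "i < N" and k: "k > 0"
  shows "euclid_norm (vec_block k v (Suc i) - vec_block k w (Suc i))
       = L2_set (\<lambda>c. v $ c - w $ c) {c. c < k * N \<and> c div k = i}"
proof -
  have "{c. c < k * N \<and> c div k = i} = (\<lambda>l. i * k + l) ` {..<k}"
  proof (intro equalityI subsetI)
    fix c assume "c \<in> {c. c < k * N \<and> c div k = i}"
    then have "c = i * k + c mod k" "c mod k < k" using k by (auto simp: div_mult_mod_eq)
    then show "c \<in> (\<lambda>l. i * k + l) ` {..<k}" by blast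
  next
    fix c assume "c \<in> (\<lambda>l. i * k + l) ` {..<k}"
    then obtain l where l: "c = i * k + l" "l < k" by auto
    have "c < Suc i * k" using l by simp
    also have "\<dots> \<le> N * k" using assms(1) by (intro mult_le_mono1) simp
    finally show "c \<in> {c. c < k * N \<and> c div k = i}" using l by (simp add: mult.commute)
  qed
  then have "L2_set (\<lambda>c. v $ c - w $ c) {c. c < k * N \<and> c div k = i}
      = L2_set (\<lambda>l. v $ (i * k + l) - w $ (i * k + l)) {..<k}"
    by (simp add: L2_set_def sum.reindex inj_on_def)
  then show ?thesis
    by (simp add: euclid_norm_eq_L2_set vec_block_def cong: L2_set_cong_simp)
qed

theorem theorem3:
  fixes N nx nu nw n m :: nat
    and A B E F :: "nat \<Rightarrow> real mat"
    and G :: "real mat"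
    and p d d' :: "real vec"
    and \<Gamma> \<rho> :: real
  assumes "N \<ge> 1"
    and "n = nx + nu" and "n \<ge> 1"
    and "m = 4 * nx + 2 * nu + 2 * nw"
    and "\<And>i. 1 \<le> i \<Longrightarrow> i \<le> N - 1 \<Longrightarrow> A i \<in> carrier_mat nx nx"
    and "\<And>i. 1 \<le> i \<Longrightarrow> i \<le> N - 1 \<Longrightarrow> B i \<in> carrier_mat nx nu"
    and "\<And>i. 1 \<le> i \<Longrightarrow> i \<le> N \<Longrightarrow> E i \<in> carrier_mat nw nx"
    and "\<And>i. 1 \<le> i \<Longrightarrow> i \<le> N \<Longrightarrow> F i \<in> carrier_mat nw nu"
    and "G = mpc_matrix N nx nu nw A B E F"
    and "p \<in> carrier_vec (n * N)"
    and "\<Gamma> = sigma_upper G p / (sigma_lower G p)\<^sup>2"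
    and "\<rho> = ((sigma_upper G p)\<^sup>2 - (sigma_lower G p)\<^sup>2) /
             ((sigma_upper G p)\<^sup>2 + (sigma_lower G p)\<^sup>2)"
    and "d \<in> lp_feasible_data G" and "d' \<in> lp_feasible_data G"
  shows "\<exists>z z'. lp_solution G p d z \<and> lp_solution G p d' z' \<and>
           (\<forall>i\<in>{1..N}. euclid_norm (vec_block n z i - vec_block n z' i)
              \<le> (\<Sum>j = 1..N. \<Gamma> * \<rho> ^ nat (max 0 (\<bar>int i - int j\<bar> - 1)) *
                   euclid_norm (vec_block m d j - vec_block m d' j)))"
proof -
  have dims: "dim_row G = m * N" "dim_col G = n * N"
    using assms(2,4,9) by (simp_all add: mpc_matrix_dim)
  have n: "n > 0" and m: "m > 0" using assms(2-4) by auto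
  \<comment> \<open>Bounding each component from the side towards which the cost pushes it is dual feasible.\<close>
  define \<tau> where "\<tau> q c = (c div n) * m + bound_row nx nu nw (q c < 0) (c mod n)" for q :: "nat \<Rightarrow> real" and c
  have unit: "\<tau> q c < m * N"
    "entry_rows G (\<tau> q c) c' = (if q c < 0 then - 1 else 1) * of_bool (c = c')"
    if "c < n * N" "c' < n * N" for q c c'
    using mpc_matrix_bound_row[of c nx nu N c' A B E nw F "q c < 0"] assms(2,4-9) that
    by (simp_all add: \<tau>_def entry_rows_def)
  have start: "\<exists>B W. dual_rows (dim_col G) (entry_rows G) B W \<and> B \<subseteq> {..<dim_row G}
      \<and> (\<forall>b\<in>B. dot (dim_col G) q (W b) \<ge> 0)" for q
  proof (intro exI conjI ballI)
    show "dual_rows (dim_col G) (entry_rows G) (\<tau> q ` {..<n * N}) (entry_rows G)"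
      unfolding dims
      by (rule dual_rows_signed_unit_rows[where s = "\<lambda>c. if q c < 0 then - 1 else 1"])
        (auto simp: unit(2))
    show "\<tau> q ` {..<n * N} \<subseteq> {..<dim_row G}" using unit(1) by (auto simp: dims)
    fix b assume "b \<in> \<tau> q ` {..<n * N}"
    then obtain c where c: "c < n * N" "b = \<tau> q c" by auto
    have "dot (dim_col G) q (entry_rows G b)
        = (\<Sum>c'<n * N. (q c' * (if q c < 0 then - 1 else 1)) * of_bool (c = c'))"
      unfolding dot_def dims c(2) using c(1) by (intro sum.cong) (simp_all add: unit(2))
    also have "\<dots> = q c * (if q c < 0 then - 1 else 1)" using c(1) by (intro sum_of_bool_eq) auto
    finally show "dot (dim_col G) q (entry_rows G b) \<ge> 0" by simp
  qed
  have "\<exists>z z'. lp_solution G p d z \<and> lp_solution G p d' z' \<and>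
    (\<forall>i. L2_set (\<lambda>c. z $ c - z' $ c) {c. c < dim_col G \<and> c div n = i}
      \<le> (\<Sum>j<N. \<Gamma> * \<rho> ^ nat (\<bar>int i - int j\<bar> - 1) *
            L2_set (\<lambda>r. d $ r - d' $ r) {r \<in> {..<dim_row G}. r div m = j}))"
    unfolding assms(11,12)
  proof (rule banded_lp_decay[where cb = "\<lambda>c. c div n" and rb = "\<lambda>r. r div m" and J = "{..<N}"])
    show "dim_col G \<ge> 1" using n assms(1) by (simp add: dims)
    show "p \<in> carrier_vec (dim_col G)" using assms(10) by (simp add: dims)
    show "c div n = r div m \<or> Suc (c div n) = r div m"
      if "r \<in> {..<dim_row G}" "c < dim_col G" "entry_rows G r c \<noteq> 0" for r c
      using mpc_matrix_band[of r nx nu nw N c A B E F] that assms(2,4,9)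
      by (simp add: mpc_matrix_dim entry_rows_def)
    show "(\<lambda>r. r div m) ` {..<dim_row G} \<subseteq> {..<N}"
      by (auto simp: dims less_mult_imp_div_less mult.commute)
  qed (use start assms(13,14) in auto)
  then obtain z z' where z: "lp_solution G p d z" "lp_solution G p d' z'"
    and le: "\<And>i. L2_set (\<lambda>c. z $ c - z' $ c) {c. c < n * N \<and> c div n = i}
      \<le> (\<Sum>j<N. \<Gamma> * \<rho> ^ nat (\<bar>int i - int j\<bar> - 1) *
            L2_set (\<lambda>r. d $ r - d' $ r) {r. r < m * N \<and> r div m = j})"
    by (auto simp: dims)
  show ?thesis
  proof (intro exI conjI ballI)
    show "lp_solution G p d z" "lp_solution G p d' z'" by fact+
    fix i assume "i \<in> {1..N}"
    \<comment> \<open>Stages are numbered from 1, whereas the blocks given by div are numbered from 0.\<close>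
    then obtain i' where i: "i = Suc i'" "i' < N" by (cases i) auto
    have "euclid_norm (vec_block n z i - vec_block n z' i)
        \<le> (\<Sum>j<N. \<Gamma> * \<rho> ^ nat (\<bar>int i' - int j\<bar> - 1) *
            L2_set (\<lambda>r. d $ r - d' $ r) {r. r < m * N \<and> r div m = j})"
      using le[of i'] unfolding i(1) euclid_norm_block_diff[OF i(2) n] .
    also have "\<dots> = (\<Sum>j<N. \<Gamma> * \<rho> ^ nat (max 0 (\<bar>int i - int (Suc j)\<bar> - 1)) *
            euclid_norm (vec_block m d (Suc j) - vec_block m d' (Suc j)))"
    proof (rule sum.cong[OF refl])
      fix j assume "j \<in> {..<N}"
      moreover have "nat (max 0 (\<bar>int i - int (Suc j)\<bar> - 1)) = nat (\<bar>int i' - int j\<bar> - 1)"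
        using i(1) by (auto simp: max_def)
      ultimately show "\<Gamma> * \<rho> ^ nat (\<bar>int i' - int j\<bar> - 1) *
            L2_set (\<lambda>r. d $ r - d' $ r) {r. r < m * N \<and> r div m = j}
          = \<Gamma> * \<rho> ^ nat (max 0 (\<bar>int i - int (Suc j)\<bar> - 1)) *
            euclid_norm (vec_block m d (Suc j) - vec_block m d' (Suc j))"
        using euclid_norm_block_diff[of j N m d d'] m by simp
    qed
    also have "\<dots> = (\<Sum>j = 1..N. \<Gamma> * \<rho> ^ nat (max 0 (\<bar>int i - int j\<bar> - 1)) *
            euclid_norm (vec_block m d j - vec_block m d' j))"
      by (rule sum.reindex_bij_witness[of _ "\<lambda>j. j - 1" Suc]) auto
    finally show "euclid_norm (vec_block n z i - vec_block n z' i)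
        \<le> (\<Sum>j = 1..N. \<Gamma> * \<rho> ^ nat (max 0 (\<bar>int i - int j\<bar> - 1)) *
            euclid_norm (vec_block m d j - vec_block m d' j))" .
  qed
qed

end
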